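(* If $\kappa<\beta\sigma^2/4$, then any solution $\boldsymbol\mu=(\mu_t)_{t\ge0}$ of the Kuramoto mean field game with interaction parameter $\kappa$ (started from any initial distribution) converges to the incoherent state; that is, as $t\to\infty$, $\mu_t$ converges in law to the uniform measure $U$.
   Context: Fixed constants $\beta>0$ (discount), $\sigma>0$ (noise), and the interaction parameter $\kappa>0$. State space: the torus $\mathbb T=\mathbb R/(2\pi\mathbb Z)$; $\mathcal P(\mathbb T)$ is the set of Borel probability measures on $\mathbb T$; $\nu(f)=\int_{\mathbb T} f\,d\nu$; $U(dx)=dx/(2\pi)$ is the uniform measure. A filtered probability space satisfying the usual conditions is fixed, carrying a Brownian motion $B$ adapted to the filtration, with $\mathcal F_0$ rich enough that every $\mu_0\in\mathcal P(\mathbb T)$ is the law of some $\mathcal F_0$-measurable $\mathbb T$-valued $X_0$. $\mathcal A$ is the set of real-valued progressively measurable processes $\alpha=(\alpha_t)_{t\ge0}$. Given a flow $\boldsymbol\mu=(\mu_t)_{t\ge0}$ in $\mathcal P(\mathbb T)$, set $\ell_{\boldsymbol\mu}(t,x)=-\kappa\mu_t(\cos)\cos(x)-\kappa\mu_t(\sin)\sin(x)$ and $$J_{\boldsymbol\mu,\kappa}(\alpha)=\mathbb E\int_0^\infty e^{-\beta t}\Big(\ell_{\boldsymbol\mu}(t,X^\alpha_t)+\tfrac12\alpha_t^2\Big)dt,\qquad X^\alpha_t=X_0+\int_0^t\alpha_u\,du+\sigma B_t,$$ where $X_0$ has law $\mu_0$. The flow $\boldsymbol\mu$ is a solution of the Kuramoto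 mean field game with interaction parameter $\kappa$ starting from $\mu_0$ if there is $\alpha^*\in\mathcal A$ with $J_{\boldsymbol\mu,\kappa}(\alpha^* )=\inf_{\alpha\in\mathcal A}J_{\boldsymbol\mu,\kappa}(\alpha)$ and $\mu_t$ is the law of $X^{\alpha^*}_t$ on $\mathbb T$ for all $t\ge0$. *)

theory Defs
  imports "HOL-Probability.Probability"
begin

section \<open>The torus\<close>

definition torus_rel :: "real \<Rightarrow> real \<Rightarrow> bool" where
  "torus_rel x y \<longleftrightarrow> (\<exists>k::int. x - y = 2 * pi * of_int k)"

lemma torus_rel_refl: "torus_rel x x"
  unfolding torus_rel_def by (rule exI[of _ 0]) simp

lemma torus_rel_sym: "torus_rel x y \<Longrightarrow> torus_rel y x"
proof -
  assume "torus_rel x y"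
  then obtain k :: int where "x - y = 2 * pi * of_int k"
    by (auto simp: torus_rel_def)
  then have "y - x = 2 * pi * of_int (- k)"
    by simp
  then show ?thesis
    unfolding torus_rel_def by blast
qed

lemma torus_rel_add:
  assumes "torus_rel x y" "torus_rel x' y'" shows "torus_rel (x + x') (y + y')"
proof -
  from assms obtain k l :: int
    where "x - y = 2 * pi * of_int k" "x' - y' = 2 * pi * of_int l"
    by (auto simp: torus_rel_def)
  then have "(x + x') - (y + y') = 2 * pi * of_int (k + l)"
    by (simp add: algebra_simps)
  then show ?thesis
    unfolding torus_rel_def by blast
qed

lemma torus_rel_trans: "torus_rel x y \<Longrightarrow> torus_rel y z \<Longrightarrow> torus_rel x z"
  using torus_rel_add[of x y y z] by (simp add: torus_rel_def)

lemma equivp_torus_rel: "equivp torus_rel"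
  by (intro equivpI reflpI sympI transpI)
     (auto intro: torus_rel_refl torus_rel_sym torus_rel_trans)

quotient_type torus = real / torus_rel
  morphisms rep_torus to_torus
  by (rule equivp_torus_rel)

text \<open>The group structure and the topology are those of the quotient
  \<open>\<real> / 2\<pi>\<int>\<close>.\<close>

instantiation torus :: ab_group_add
begin

lift_definition zero_torus :: torus is "0 :: real" .

lift_definition plus_torus :: "torus \<Rightarrow> torus \<Rightarrow> torus" is "(+) :: real \<Rightarrow> _"
  by (rule torus_rel_add)

lift_definition uminus_torus :: "torus \<Rightarrow> torus" is "uminus :: real \<Rightarrow> _"
proof -
  fix x y assume "torus_rel x y"
  then show "torus_rel (- x) (- y)"
    using torus_rel_sym[of x y] by (simp add: torus_rel_def)
qed

definition minus_torus :: "torus \<Rightarrow> torus \<Rightarrow> torus" where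
  "minus_torus x y = x + - y"

instance
proof
  fix a b c :: torus
  show "a + b + c = a + (b + c)"
    by transfer (simp add: torus_rel_refl add.assoc)
  show "a + b = b + a"
    by transfer (simp add: torus_rel_refl add.commute)
  show "0 + a = a"
    by transfer (simp add: torus_rel_refl)
  show "- a + a = 0"
    by transfer (simp add: torus_rel_refl)
  show "a - b = a + - b"
    by (rule minus_torus_def)
qed

end

instantiation torus :: topological_space
begin

definition open_torus :: "torus set \<Rightarrow> bool" where
  "open_torus S \<longleftrightarrow> open (to_torus -` S)"

instance
proof
  show "open (UNIV :: torus set)"
    by (simp add: open_torus_def)
  show "open (S \<inter> T)" if "open S" "open T" for S T :: "torus set"
    using that by (auto simp: open_torus_def)
  show "open (\<Union>K)" if "\<forall>S\<in>K. open S" for K :: "torus set set"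
    using that by (auto simp: open_torus_def vimage_Union)
qed

end

lift_definition torus_cos :: "torus \<Rightarrow> real" is cos
proof -
  fix x y assume "torus_rel x y"
  then obtain k :: int where "x = y + 2 * pi * of_int k"
    by (metis torus_rel_def diff_eq_eq add.commute)
  then show "cos x = cos y"
    by (simp add: cos_add cos_int_2pin sin_int_2pin)
qed

lift_definition torus_sin :: "torus \<Rightarrow> real" is sin
proof -
  fix x y assume "torus_rel x y"
  then obtain k :: int where "x = y + 2 * pi * of_int k"
    by (metis torus_rel_def diff_eq_eq add.commute)
  then show "sin x = sin y"
    by (simp add: sin_add cos_int_2pin sin_int_2pin)
qed

definition borel_probs :: "'a::topological_space measure set" where
  "borel_probs = {\<nu>. prob_space \<nu> \<and> sets \<nu> = sets borel}"

definition uniform_torus :: "torus measure" where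
  "uniform_torus = distr (uniform_measure lborel {0..<2 * pi}) borel to_torus"

definition converges_in_law ::
    "(real \<Rightarrow> 'a::topological_space measure) \<Rightarrow> 'a measure \<Rightarrow> bool" where
  "converges_in_law \<mu> \<nu> \<longleftrightarrow>
     (\<forall>f :: 'a \<Rightarrow> real. continuous_on UNIV f \<and> bounded (range f) \<longrightarrow>
        ((\<lambda>t. \<integral>x. f x \<partial>\<mu> t) \<longlongrightarrow> (\<integral>x. f x \<partial>\<nu>)) at_top)"


section \<open>The filtered probability space\<close>

text \<open>Time is a real number. Only times \<open>t \<ge> 0\<close> are meaningful: a filtration
  indexed by \<open>[0, \<infinity>)\<close> is read as one indexed by \<open>\<real>\<close>, e.g. by
  \<open>F t = F 0\<close> for \<open>t < 0\<close>.\<close>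

locale usual_filtered_space =
  prob_space M + complete_measure M + filtration "space M" F
  for M :: "'a measure" and F :: "real \<Rightarrow> 'a measure" +
  assumes subalgebra_F: "t \<ge> 0 \<Longrightarrow> subalgebra M (F t)"
    and null_sets_F: "null_sets M \<subseteq> sets (F 0)"
    and right_continuous_F: "t \<ge> 0 \<Longrightarrow> sets (F t) = (\<Inter>s\<in>{t<..}. sets (F s))"

locale brownian_motion = usual_filtered_space M F
  for M :: "'a measure" and F :: "real \<Rightarrow> 'a measure" +
  fixes B :: "real \<Rightarrow> 'a \<Rightarrow> real"
  assumes adapted_B: "t \<ge> 0 \<Longrightarrow> B t \<in> borel_measurable (F t)"
    and B_0: "AE \<omega> in M. B 0 \<omega> = 0"
    and continuous_B: "AE \<omega> in M. continuous_on {0..} (\<lambda>t. B t \<omega>)"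
    and normal_increments_B: "0 \<le> s \<Longrightarrow> s < t \<Longrightarrow>
      distributed M lborel (\<lambda>\<omega>. B t \<omega> - B s \<omega>) (normal_density 0 (sqrt (t - s)))"
    and indep_increments_B: "0 \<le> s \<Longrightarrow> s < t \<Longrightarrow>
      indep_set (sets (F s)) {(\<lambda>\<omega>. B t \<omega> - B s \<omega>) -` A \<inter> space M | A. A \<in> sets borel}"

locale kuramoto_space = brownian_motion M F B
  for M :: "'a measure" and F :: "real \<Rightarrow> 'a measure" and B :: "real \<Rightarrow> 'a \<Rightarrow> real" +
  assumes rich_F_0: "\<nu> \<in> (borel_probs :: torus measure set) \<Longrightarrow>
      \<exists>X\<^sub>0 \<in> F 0 \<rightarrow>\<^sub>M borel. distr M borel X\<^sub>0 = \<nu>"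

definition controls :: "(real \<Rightarrow> 'a measure) \<Rightarrow> (real \<Rightarrow> 'a \<Rightarrow> real) set" where
  "controls F = {\<alpha>. \<forall>t\<ge>0. (\<lambda>(s, \<omega>). \<alpha> s \<omega>) \<in>
      borel_measurable (restrict_space borel {0..t} \<Otimes>\<^sub>M F t)}"


section \<open>The Kuramoto mean field game\<close>

text \<open>Controls are not required to be integrable. The Bochner integral below is \<open>0\<close>
  where \<open>\<alpha>\<close> fails to be integrable on \<open>[0, t]\<close>; if this happens with positive
  probability then the quadratic cost is infinite whatever the state is.\<close>

definition state ::
    "(real \<Rightarrow> 'a \<Rightarrow> real) \<Rightarrow> real \<Rightarrow> ('a \<Rightarrow> torus) \<Rightarrow> (real \<Rightarrow> 'a \<Rightarrow> real)
      \<Rightarrow> real \<Rightarrow> 'a \<Rightarrow> torus" where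
  "state B \<sigma> X\<^sub>0 \<alpha> t \<omega> =
     X\<^sub>0 \<omega> + to_torus ((LINT u:{0..t}|lborel. \<alpha> u \<omega>) + \<sigma> * B t \<omega>)"

definition interaction_cost :: "real \<Rightarrow> (real \<Rightarrow> torus measure) \<Rightarrow> real \<Rightarrow> torus \<Rightarrow> real" where
  "interaction_cost \<kappa> \<mu> t x =
     - \<kappa> * (\<integral>y. torus_cos y \<partial>\<mu> t) * torus_cos x
     - \<kappa> * (\<integral>y. torus_sin y \<partial>\<mu> t) * torus_sin x"

text \<open>The Lebesgue integral with values in \<open>[-\<infinity>, \<infinity>]\<close>, as the integral of the positive
  part minus that of the negative part (\<^const>\<open>e2ennreal\<close> sends negative values to \<open>0\<close>).
  In the cost functional the negative part always has a finite integral, since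
  \<^const>\<open>interaction_cost\<close> is bounded.\<close>

definition ext_integral :: "'a measure \<Rightarrow> ('a \<Rightarrow> ereal) \<Rightarrow> ereal" where
  "ext_integral M f =
     enn2ereal (\<integral>\<^sup>+x. e2ennreal (f x) \<partial>M) - enn2ereal (\<integral>\<^sup>+x. e2ennreal (- f x) \<partial>M)"

definition cost ::
    "'a measure \<Rightarrow> (real \<Rightarrow> 'a \<Rightarrow> real) \<Rightarrow> real \<Rightarrow> real \<Rightarrow> real \<Rightarrow> (real \<Rightarrow> torus measure)
      \<Rightarrow> ('a \<Rightarrow> torus) \<Rightarrow> (real \<Rightarrow> 'a \<Rightarrow> real) \<Rightarrow> ereal" where
  "cost M B \<beta> \<sigma> \<kappa> \<mu> X\<^sub>0 \<alpha> =
     ext_integral M (\<lambda>\<omega>. ext_integral (restrict_space lborel {0..}) (\<lambda>t.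
       ereal (exp (- \<beta> * t) *
         (interaction_cost \<kappa> \<mu> t (state B \<sigma> X\<^sub>0 \<alpha> t \<omega>) + (\<alpha> t \<omega>)\<^sup>2 / 2))))"

definition kuramoto_mfg_solution ::
    "'a measure \<Rightarrow> (real \<Rightarrow> 'a measure) \<Rightarrow> (real \<Rightarrow> 'a \<Rightarrow> real) \<Rightarrow> real \<Rightarrow> real \<Rightarrow> real
      \<Rightarrow> torus measure \<Rightarrow> (real \<Rightarrow> torus measure) \<Rightarrow> bool" where
  "kuramoto_mfg_solution M F B \<beta> \<sigma> \<kappa> \<mu>\<^sub>0 \<mu> \<longleftrightarrow>
     (\<forall>t\<ge>0. \<mu> t \<in> borel_probs) \<and> \<mu> 0 = \<mu>\<^sub>0 \<and>
     (\<exists>X\<^sub>0 \<in> F 0 \<rightarrow>\<^sub>M borel. distr M borel X\<^sub>0 = \<mu>\<^sub>0 \<and>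
       (\<exists>\<alpha>' \<in> controls F.
          cost M B \<beta> \<sigma> \<kappa> \<mu> X\<^sub>0 \<alpha>' = (INF \<alpha>\<in>controls F. cost M B \<beta> \<sigma> \<kappa> \<mu> X\<^sub>0 \<alpha>) \<and>
          (\<forall>t\<ge>0. \<mu> t = distr M borel (state B \<sigma> X\<^sub>0 \<alpha>' t))))"

end

theory Submission
  imports Defs
begin

text \<open>Write \<open>Y\<^sub>t = \<xi> + \<integral>\<^sub>0\<^sup>t \<alpha>\<^sub>u du + \<sigma> B\<^sub>t\<close> for a real lift of the optimal state process, and
  \<open>m\<^sub>k(t) = E exp(i k Y\<^sub>t)\<close> for the Fourier coefficients of its law \<open>\<mu>\<^sub>t\<close>.  The torus is
  compact, so weak convergence to the uniform measure means \<open>m\<^sub>k(t) \<rightarrow> 0\<close> for every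
  \<open>k \<noteq> 0\<close> (\<open>converges_in_law_uniform_torusI\<close>).

  Two effects compete.  The noise destroys the Fourier coefficients: over a time step \<open>h\<close> the
  increment of the Brownian motion is independent of the past and multiplies \<open>m\<^sub>k\<close> by
  \<open>exp(- k\<^sup>2 \<sigma>\<^sup>2 h / 2)\<close>.  The control may restore them, but only by at most
  \<open>\<bar>k\<bar> E \<integral>\<^sub>t\<^sup>t\<^sup>+\<^sup>h \<bar>\<alpha>\<^sub>u\<bar> du\<close>, because \<open>y \<mapsto> exp(i k y)\<close> is \<open>\<bar>k\<bar>\<close>-Lipschitz
  (\<open>fourier_step\<close>).

  The effort of an optimal control is bounded by the reward that it can earn.  At time \<open>t\<close> the
  interaction cost is the Lipschitz function \<open>- \<kappa> Re (cnj m\<^sub>1(t) exp(i y))\<close> of \<open>y\<close>, with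
  constant \<open>\<kappa> \<bar>m\<^sub>1(t)\<bar>\<close>.  Reducing the control slightly towards \<open>0\<close> on \<open>[a, a + h]\<close>,
  that is, adding \<open>- \<epsilon> sgn(\<alpha>\<^sub>u) e\<^sup>\<beta>\<^sup>u\<close> there, saves \<open>\<epsilon> E \<integral>\<^sub>a\<^sup>a\<^sup>+\<^sup>h \<bar>\<alpha>\<^sub>u\<bar> du\<close> of quadratic
  cost to first order, whereas the displaced path loses at most \<open>\<epsilon> \<kappa> S h / \<beta>\<close>, where \<open>S\<close>
  bounds \<open>\<bar>m\<^sub>1\<bar>\<close> on \<open>[a, \<infinity>)\<close>.  Optimality therefore gives
  \<open>E \<integral>\<^sub>a\<^sup>a\<^sup>+\<^sup>h \<bar>\<alpha>\<^sub>u\<bar> du \<le> \<kappa> S h / \<beta>\<close> (\<open>control_budget\<close>).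

  With \<open>h = 2 / \<sigma>\<^sup>2\<close> the noise factor is at most \<open>e\<^sup>-\<^sup>1 \<le> 1/2\<close>, and \<open>\<kappa> h / \<beta> < 1/2\<close> is
  the assumption on \<open>\<kappa>\<close>.  Hence \<open>q = e\<^sup>-\<^sup>1 + \<kappa> h / \<beta> < 1\<close>, and by induction
  \<open>\<bar>m\<^sub>k(t)\<bar> \<le> \<bar>k\<bar> q\<^sup>n\<close> for all \<open>t \<ge> n h\<close> (\<open>fourier_decay\<close>).\<close>

section \<open>Fourier analysis on the torus\<close>

lemma torus_cos_to_torus [simp]: "torus_cos (to_torus y) = cos y"
  by (rule torus_cos.abs_eq)

lemma torus_sin_to_torus [simp]: "torus_sin (to_torus y) = sin y"
  by (rule torus_sin.abs_eq)

lemma to_torus_add: "to_torus x + to_torus y = to_torus (x + y)"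
  by (rule plus_torus.abs_eq)

lemma continuous_on_to_torus: "continuous_on UNIV to_torus"
  by (simp add: continuous_on_open_vimage open_torus_def)

lemma continuous_on_torusI:
  assumes "continuous_on UNIV (\<lambda>y. f (to_torus y))"
  shows "continuous_on UNIV f"
  using assms by (simp add: continuous_on_open_vimage open_torus_def vimage_def)

lemma continuous_on_torus_cos: "continuous_on UNIV torus_cos"
  by (rule continuous_on_torusI) (simp, intro continuous_intros)

lemma continuous_on_torus_sin: "continuous_on UNIV torus_sin"
  by (rule continuous_on_torusI) (simp, intro continuous_intros)

lemma borel_measurable_torus_sin [measurable]: "torus_sin \<in> borel_measurable borel"
  by (rule borel_measurable_continuous_onI[OF continuous_on_torus_sin])

lemma measurable_to_torus [measurable]: "to_torus \<in> borel \<rightarrow>\<^sub>M borel"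
  by (rule borel_measurable_continuous_onI[OF continuous_on_to_torus])

text \<open>Cosine and sine together determine a point of the torus.  This yields the Hausdorff
  property and the separation of points required by the Stone-Weierstrass theorem.\<close>

lemma torus_eqI:
  assumes "torus_cos x = torus_cos y" "torus_sin x = torus_sin y"
  shows "x = y"
proof -
  obtain a b where x: "x = to_torus a" and y: "y = to_torus b"
    by (metis Quotient3_abs_rep[OF Quotient3_torus])
  have "sin a = sin b \<and> cos a = cos b"
    using assms by (simp add: x y)
  then obtain n :: int where "a = b + 2 * pi * n"
    using sin_cos_eq_iff by metis
  then have "torus_rel a b"
    by (auto simp: torus_rel_def)
  then show ?thesis
    by (simp add: x y torus.abs_eq_iff)
qed

instance torus :: t2_space
proof
  fix x y :: torus assume "x \<noteq> y"
  then consider "torus_cos x \<noteq> torus_cos y" | "torus_sin x \<noteq> torus_sin y"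
    using torus_eqI by blast
  then obtain f :: "torus \<Rightarrow> real" where f: "continuous_on UNIV f" "f x \<noteq> f y"
    using continuous_on_torus_cos continuous_on_torus_sin by metis
  from hausdorff[OF f(2)] obtain U V where
    UV: "open U" "open V" "f x \<in> U" "f y \<in> V" "U \<inter> V = {}" by blast
  show "\<exists>U V. open U \<and> open V \<and> x \<in> U \<and> y \<in> V \<and> U \<inter> V = {}"
    using UV f(1) by (intro exI[of _ "f -` U"] exI[of _ "f -` V"])
      (auto simp: continuous_on_open_vimage)
qed

text \<open>A Borel section of the quotient map.  It lets every torus-valued random variable be
  replaced by a real one, so that the state of the game becomes a real process.\<close>

definition torus_arg :: "torus \<Rightarrow> real" where
  "torus_arg x = (if 0 \<le> torus_sin x then arccos (torus_cos x) else - arccos (torus_cos x))"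

lemma torus_cos_bounds: "-1 \<le> torus_cos x" "torus_cos x \<le> 1"
  by (transfer; simp)+

lemma torus_sin_cos_squared: "(torus_sin x)\<^sup>2 + (torus_cos x)\<^sup>2 = 1"
  by (transfer; simp)

lemma to_torus_torus_arg: "to_torus (torus_arg x) = x"
proof (rule torus_eqI)
  show "torus_cos (to_torus (torus_arg x)) = torus_cos x"
    using torus_cos_bounds[of x] by (simp add: torus_arg_def cos_arccos_abs)
  have "1 - (torus_cos x)\<^sup>2 = (torus_sin x)\<^sup>2"
    using torus_sin_cos_squared[of x] by simp
  then have "sin (arccos (torus_cos x)) = \<bar>torus_sin x\<bar>"
    using torus_cos_bounds[of x] by (simp add: sin_arccos)
  then show "torus_sin (to_torus (torus_arg x)) = torus_sin x"
    by (simp add: torus_arg_def)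
qed

lemma measurable_torus_arg [measurable]: "torus_arg \<in> borel_measurable borel"
proof -
  have "continuous_on UNIV (\<lambda>x. arccos (torus_cos x))"
    using torus_cos_bounds by (intro continuous_on_arccos continuous_on_torus_cos) auto
  then have [measurable]: "(\<lambda>x. arccos (torus_cos x)) \<in> borel_measurable borel"
    by (rule borel_measurable_continuous_onI)
  show ?thesis
    unfolding torus_arg_def by measurable
qed

lemma compact_torus: "compact (UNIV :: torus set)"
proof -
  have "torus_arg x \<in> {-pi..pi}" for x
    using torus_cos_bounds[of x] arccos_lbound[of "torus_cos x"] arccos_ubound[of "torus_cos x"]
    by (auto simp: torus_arg_def)
  then have "x \<in> to_torus ` {-pi..pi}" for x
    by (metis imageI to_torus_torus_arg)
  then have "UNIV = to_torus ` {-pi..pi}"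
    by auto
  moreover have "compact (to_torus ` {-pi..pi})"
    by (intro compact_continuous_image continuous_on_subset[OF continuous_on_to_torus]) auto
  ultimately show ?thesis by simp
qed

lift_definition torus_char :: "int \<Rightarrow> torus \<Rightarrow> complex" is "\<lambda>k y. cis (of_int k * y)"
proof -
  fix k :: int and x y assume "torus_rel x y"
  then obtain n :: int where "x = y + 2 * pi * of_int n"
    by (metis torus_rel_def diff_eq_eq add.commute)
  then have "of_int k * x = of_int k * y + 2 * pi * of_int (k * n)"
    by (simp add: algebra_simps)
  then show "cis (of_int k * x) = cis (of_int k * y)"
    by (simp add: cis.code cos_add sin_add cos_int_2pin sin_int_2pin del: of_int_mult)
qed

lemma torus_char_to_torus [simp]: "torus_char k (to_torus y) = cis (of_int k * y)"
  by (rule torus_char.abs_eq)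

lemma torus_char_0 [simp]: "torus_char 0 x = 1"
  by (transfer) simp

lemma norm_torus_char [simp]: "norm (torus_char k x) = 1"
  by (transfer) simp

lemma torus_char_mult: "torus_char k x * torus_char l x = torus_char (k + l) x"
  by (transfer) (simp add: cis_mult distrib_right)

lemma continuous_on_torus_char: "continuous_on UNIV (torus_char k)"
  by (rule continuous_on_torusI) (simp, intro continuous_intros)

lemma measurable_torus_char [measurable]: "torus_char k \<in> borel_measurable borel"
  by (rule borel_measurable_continuous_onI[OF continuous_on_torus_char])

text \<open>The coefficients are complex so that the class is visibly closed under products; the
  real trigonometric polynomials are its real-valued members.\<close>

inductive trig_poly :: "(torus \<Rightarrow> complex) \<Rightarrow> bool" where
  char: "trig_poly (\<lambda>x. c * torus_char k x)"
| add: "trig_poly f \<Longrightarrow> trig_poly g \<Longrightarrow> trig_poly (\<lambda>x. f x + g x)"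

lemma trig_poly_mult:
  assumes "trig_poly f" "trig_poly g"
  shows "trig_poly (\<lambda>x. f x * g x)"
  using assms
proof (induction f rule: trig_poly.induct)
  case (char c k)
  from char show ?case
  proof (induction g rule: trig_poly.induct)
    case (char d l)
    have "(c * torus_char k x) * (d * torus_char l x) = (c * d) * torus_char (k + l) x" for x
      by (simp flip: torus_char_mult)
    then show ?case by (simp only: trig_poly.char)
  next
    case (add f g)
    then show ?case by (simp add: distrib_left trig_poly.add)
  qed
next
  case (add f g)
  then show ?case by (simp add: distrib_right trig_poly.add)
qed

lemma trig_poly_continuous: "trig_poly f \<Longrightarrow> continuous_on UNIV f"
  by (induction rule: trig_poly.induct) (intro continuous_intros continuous_on_torus_char; assumption)+

lemma trig_poly_const: "trig_poly (\<lambda>x. c)"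
  using trig_poly.char[of c 0] by simp

lemma trig_poly_cos: "trig_poly (\<lambda>x. of_real (torus_cos x))"
proof -
  have "of_real (torus_cos x) = (1/2) * torus_char 1 x + (1/2) * torus_char (-1) x" for x
    by (transfer) (simp add: complex_eq_iff)
  then show ?thesis by (simp only: trig_poly.intros)
qed

lemma trig_poly_sin: "trig_poly (\<lambda>x. of_real (torus_sin x))"
proof -
  have "of_real (torus_sin x) = (- \<i>/2) * torus_char 1 x + (\<i>/2) * torus_char (-1) x" for x
    by (transfer) (simp add: complex_eq_iff)
  then show ?thesis by (simp only: trig_poly.intros)
qed

text \<open>The Stone-Weierstrass theorem on the torus itself, which is a compact Hausdorff space.\<close>

lemma trig_poly_dense:
  fixes f :: "torus \<Rightarrow> real"
  assumes "continuous_on UNIV f" "e > 0"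
  shows "\<exists>g. trig_poly (\<lambda>x. of_real (g x)) \<and> (\<forall>x. \<bar>f x - g x\<bar> < e)"
proof -
  interpret function_ring_on "{g. trig_poly (\<lambda>x. of_real (g x))}" UNIV
  proof
    fix f g :: "torus \<Rightarrow> real"
    show "continuous_on UNIV f" if "f \<in> {g. trig_poly (\<lambda>x. of_real (g x))}"
    proof -
      have "continuous_on UNIV (\<lambda>x. Re (of_real (f x)))"
        using that by (intro continuous_on_Re trig_poly_continuous) simp
      then show ?thesis by simp
    qed
  qed (use torus_eqI trig_poly_cos trig_poly_sin in
      \<open>auto simp: compact_torus trig_poly.add trig_poly_mult trig_poly_const\<close>)
  show ?thesis
    using Stone_Weierstrass_basic[OF assms] by auto
qed

lemma borel_measurable_cis [measurable]: "cis \<in> borel_measurable borel"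
  by (intro borel_measurable_continuous_onI continuous_intros)

lemma borel_measurable_cnj [measurable]: "cnj \<in> borel_measurable borel"
  by (intro borel_measurable_continuous_onI continuous_intros)

lemma integral_cis_period:
  assumes "k \<noteq> 0"
  shows "(\<integral>x. indicator {0..2*pi} x *\<^sub>R cis (of_int k * x) \<partial>lborel) = 0"
proof -
  have "(\<integral>x. indicator {0..2*pi} x *\<^sub>R cis (of_int k * x) \<partial>lborel)
     = cis (of_int k * (2*pi)) / (\<i> * of_int k) - cis (of_int k * 0) / (\<i> * of_int k)"
  proof (rule integral_FTC_Icc)
    fix x :: real
    have "((\<lambda>z. exp (\<i> * of_int k * z) / (\<i> * of_int k)) has_field_derivative
        exp (\<i> * of_int k * of_real x)) (at (of_real x))"
      using assms by (auto intro!: derivative_eq_intros)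
    then show "((\<lambda>x. cis (of_int k * x) / (\<i> * of_int k)) has_vector_derivative
        cis (of_int k * x)) (at x within {0..2*pi})"
      using has_vector_derivative_real_field
      by (fastforce simp: cis_conv_exp mult.assoc)
  qed (auto intro!: continuous_intros)
  moreover have "cis (of_int k * (2*pi)) = 1"
    using cos_int_2pin[of k] sin_int_2pin[of k] by (simp add: cis.code mult.commute complex_eq_iff)
  ultimately show ?thesis by simp
qed

lemma prob_space_uniform_torus: "prob_space uniform_torus"
  unfolding uniform_torus_def
  by (intro prob_space.prob_space_distr prob_space_uniform_measure) auto

lemma integral_torus_char_uniform:
  assumes "k \<noteq> 0"
  shows "(\<integral>x. torus_char k x \<partial>uniform_torus) = 0"
proof -
  have "(\<integral>x. torus_char k x \<partial>uniform_torus)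
      = (\<integral>x. cis (of_int k * x) \<partial>uniform_measure lborel {0..<2 * pi})"
    unfolding uniform_torus_def
    by (subst integral_distr) auto
  also have "uniform_measure lborel {0..<2*pi}
      = density lborel (\<lambda>x. ennreal (indicator {0..<2*pi} x / (2*pi)))"
    unfolding uniform_measure_def
    by (intro density_cong AE_I2) (auto simp: divide_ennreal simp flip: ennreal_indicator)
  also have "(\<integral>x. cis (of_int k * x) \<partial>\<dots>)
      = (\<integral>x. (indicator {0..<2*pi} x / (2*pi)) *\<^sub>R cis (of_int k * x) \<partial>lborel)"
    by (intro integral_density) auto
  also have "\<dots> = (\<integral>x. (1 / (2*pi)) *\<^sub>R (indicator {0..2*pi} x *\<^sub>R cis (of_int k * x)) \<partial>lborel)"
  proof (intro integral_cong_AE)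
    show "AE x in lborel. (indicator {0..<2*pi} x / (2*pi)) *\<^sub>R cis (of_int k * x)
        = (1 / (2*pi)) *\<^sub>R (indicator {0..2*pi} x *\<^sub>R cis (of_int k * x))"
      using AE_lborel_singleton[of "2*pi"] by eventually_elim (auto split: split_indicator)
  qed auto
  also have "\<dots> = 0"
    unfolding integral_scaleR_right integral_cis_period[OF assms] by simp
  finally show ?thesis .
qed

text \<open>Weak convergence to the uniform measure is convergence of the Fourier coefficients to
  those of the uniform measure, since trigonometric polynomials are uniformly dense in the
  continuous functions.\<close>

lemma converges_in_law_uniform_torusI:
  assumes probs: "\<And>t. t \<ge> 0 \<Longrightarrow> \<mu> t \<in> borel_probs"
    and chars: "\<And>k. k \<noteq> 0 \<Longrightarrow> ((\<lambda>t. \<integral>x. torus_char k x \<partial>\<mu> t) \<longlongrightarrow> 0) at_top"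
  shows "converges_in_law \<mu> uniform_torus"
proof -
  have int: "integrable \<nu> f" if "\<nu> \<in> borel_probs" "continuous_on UNIV f"
    for \<nu> :: "torus measure" and f :: "torus \<Rightarrow> 'b::{banach, second_countable_topology}"
  proof -
    interpret prob_space \<nu> using that by (simp add: borel_probs_def)
    have "compact (range f)"
      using that(2) by (intro compact_continuous_image compact_torus)
    then obtain C where "\<And>x. norm (f x) \<le> C"
      by (metis compact_imp_bounded bounded_iff rangeI)
    moreover have "f \<in> borel_measurable \<nu>"
      using borel_measurable_continuous_onI[OF that(2)] that(1)
      by (simp add: borel_probs_def cong: measurable_cong_sets)
    ultimately show ?thesis
      by (intro integrable_const_bound[of _ C]) auto
  qed
  have U: "uniform_torus \<in> borel_probs"
    using prob_space_uniform_torus by (simp add: borel_probs_def uniform_torus_def)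
  have poly: "((\<lambda>t. \<integral>x. f x \<partial>\<mu> t) \<longlongrightarrow> (\<integral>x. f x \<partial>uniform_torus)) at_top" if "trig_poly f" for f
    using that
  proof (induction rule: trig_poly.induct)
    case (char c k)
    show ?case
    proof (cases "k = 0")
      case True
      have 1: "measure \<nu> (space \<nu>) = 1" if "\<nu> \<in> borel_probs" for \<nu> :: "torus measure"
      proof -
        interpret prob_space \<nu> using that by (simp add: borel_probs_def)
        show ?thesis by (simp add: prob_space)
      qed
      have "\<forall>\<^sub>F t in at_top. (\<integral>x. c * torus_char k x \<partial>\<mu> t) = (\<integral>x. c * torus_char k x \<partial>uniform_torus)"
        using eventually_ge_at_top[of 0]
        by eventually_elim (use 1[OF U] 1[OF probs] in \<open>simp add: True\<close>)
      then show ?thesis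
        by (rule tendsto_eventually)
    next
      case False
      then show ?thesis
        using tendsto_mult_left[OF chars[OF False], of c]
        by (simp add: integral_torus_char_uniform)
    qed
  next
    case (add f g)
    have eq: "(\<integral>x. f x + g x \<partial>\<nu>) = (\<integral>x. f x \<partial>\<nu>) + (\<integral>x. g x \<partial>\<nu>)" if "\<nu> \<in> borel_probs" for \<nu>
      using that add.hyps by (intro Bochner_Integration.integral_add int trig_poly_continuous)
    have "\<forall>\<^sub>F t in at_top. (\<integral>x. f x \<partial>\<mu> t) + (\<integral>x. g x \<partial>\<mu> t) = (\<integral>x. f x + g x \<partial>\<mu> t)"
      using eventually_ge_at_top[of 0] by eventually_elim (simp add: eq[OF probs])
    then show ?case
      unfolding eq[OF U] by (rule Lim_transform_eventually[OF tendsto_add[OF add.IH], rotated 0])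
  qed
  show ?thesis
    unfolding converges_in_law_def
  proof (intro allI impI, rule tendstoI)
    fix f :: "torus \<Rightarrow> real" and e :: real
    assume "continuous_on UNIV f \<and> bounded (range f)" and e: "0 < e"
    then have f: "continuous_on UNIV f" by simp
    from trig_poly_dense[OF f, of "e/3"] e obtain g
      where g: "trig_poly (\<lambda>x. of_real (g x))" and fg: "\<And>x. \<bar>f x - g x\<bar> < e/3" by auto
    have "continuous_on UNIV (\<lambda>x. Re (of_real (g x)))"
      by (intro continuous_on_Re trig_poly_continuous g)
    then have cg: "continuous_on UNIV g" by simp
    have close: "\<bar>(\<integral>x. f x \<partial>\<nu>) - (\<integral>x. g x \<partial>\<nu>)\<bar> \<le> e/3" if \<nu>: "\<nu> \<in> borel_probs" for \<nu>
    proof -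
      interpret prob_space \<nu> using \<nu> by (simp add: borel_probs_def)
      have "\<bar>\<integral>x. f x - g x \<partial>\<nu>\<bar> \<le> (\<integral>x. \<bar>f x - g x\<bar> \<partial>\<nu>)"
        by (rule integral_abs_bound)
      also have "\<dots> \<le> (\<integral>x. e/3 \<partial>\<nu>)"
        using fg by (intro integral_mono int[OF \<nu>] continuous_intros f cg) (auto intro: less_imp_le)
      finally show ?thesis
        by (simp add: Bochner_Integration.integral_diff int[OF \<nu>] f cg prob_space)
    qed
    have "((\<lambda>t. Re (\<integral>x. of_real (g x) \<partial>\<mu> t)) \<longlongrightarrow> Re (\<integral>x. of_real (g x) \<partial>uniform_torus)) at_top"
      by (intro tendsto_Re poly g)
    then have "((\<lambda>t. \<integral>x. g x \<partial>\<mu> t) \<longlongrightarrow> (\<integral>x. g x \<partial>uniform_torus)) at_top"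
      by simp
    then have "\<forall>\<^sub>F t in at_top. \<bar>(\<integral>x. g x \<partial>\<mu> t) - (\<integral>x. g x \<partial>uniform_torus)\<bar> < e/3"
      using e unfolding tendsto_iff dist_real_def by (meson zero_less_divide_iff zero_less_numeral)
    then show "\<forall>\<^sub>F t in at_top. dist (\<integral>x. f x \<partial>\<mu> t) (\<integral>x. f x \<partial>uniform_torus) < e"
      using eventually_ge_at_top[of 0]
    proof eventually_elim
      case (elim t)
      then show ?case
        using close[OF probs, of t] close[OF U] unfolding dist_real_def by linarith
    qed
  qed
qed

section \<open>The controlled process\<close>

lemma bounded_set_integrable_Icc:
  fixes w :: "real \<Rightarrow> real"
  assumes [measurable]: "w \<in> borel_measurable borel" and "\<And>u. 0 \<le> w u" "\<And>u. w u \<le> C"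
  shows "set_integrable lborel {a..b} w"
  unfolding set_integrable_def
proof (rule Bochner_Integration.integrable_bound[where f="\<lambda>u. C * indicator {a..b} u"])
  have "emeasure lborel {a..b} < \<infinity>" by (simp add: emeasure_lborel_Icc_eq)
  then show "integrable lborel (\<lambda>u. C * indicator {a..b} u)"
    by (intro integrable_mult_right integrable_real_indicator) auto
  show "AE u in lborel. norm (indicator {a..b} u *\<^sub>R w u) \<le> norm (C * indicator {a..b} u)"
  proof (rule AE_I2)
    fix u
    show "norm (indicator {a..b} u *\<^sub>R w u) \<le> norm (C * indicator {a..b} u)"
      using assms(2)[of u] assms(3)[of u] by (auto split: split_indicator)
  qed
qed measurable

abbreviation time :: "real measure" where
  "time \<equiv> restrict_space lborel {0..}"

definition drift :: "(real \<Rightarrow> 'a \<Rightarrow> real) \<Rightarrow> real \<Rightarrow> 'a \<Rightarrow> real" where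
  "drift \<alpha> t \<omega> = (LINT u:{0..t}|lborel. \<alpha> u \<omega>)"

context brownian_motion
begin

lemma measurable_F:
  assumes "t \<ge> 0" "f \<in> F t \<rightarrow>\<^sub>M N"
  shows "f \<in> M \<rightarrow>\<^sub>M N"
  using measurable_from_subalg[OF subalgebra_F] assms by blast

text \<open>Progressive measurability speaks of time restricted to \<open>[0, t]\<close>; clamping the time
  variable turns it into joint measurability over the whole real line.\<close>

lemma control_measurable_clamped:
  assumes "\<alpha> \<in> controls F" "t \<ge> 0"
  shows "(\<lambda>(s, \<omega>). \<alpha> (min t (max 0 s)) \<omega>) \<in> borel_measurable (borel \<Otimes>\<^sub>M F t)"
proof -
  have 1: "(\<lambda>(s, \<omega>). \<alpha> s \<omega>) \<in> borel_measurable (restrict_space borel {0..t} \<Otimes>\<^sub>M F t)"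
    using assms by (auto simp: controls_def)
  have 2: "(\<lambda>(s, \<omega>). (min t (max 0 s), \<omega>)) \<in> (borel \<Otimes>\<^sub>M F t) \<rightarrow>\<^sub>M (restrict_space borel {0..t} \<Otimes>\<^sub>M F t)"
    unfolding split_beta
    by (intro measurable_Pair measurable_restrict_space2) (use assms(2) in auto)
  show ?thesis
    using measurable_compose[OF 2 1] by (simp add: split_beta)
qed

lemma control_measurable:
  assumes "\<alpha> \<in> controls F"
  shows "(\<lambda>(s, \<omega>). \<alpha> (max 0 s) \<omega>) \<in> borel_measurable (borel \<Otimes>\<^sub>M M)"
proof (rule borel_measurable_LIMSEQ_real)
  fix n :: nat
  have "(\<lambda>x. x) \<in> M \<rightarrow>\<^sub>M F (real n)"
    by (intro measurable_F[of "real n"]) auto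
  then have "(\<lambda>(s, \<omega>). (s, \<omega>)) \<in> (borel \<Otimes>\<^sub>M M) \<rightarrow>\<^sub>M (borel \<Otimes>\<^sub>M F (real n))"
    unfolding split_beta by measurable
  from measurable_compose[OF this control_measurable_clamped[OF assms, of "real n"]]
  show "(\<lambda>(s, \<omega>). \<alpha> (min (real n) (max 0 s)) \<omega>) \<in> borel_measurable (borel \<Otimes>\<^sub>M M)"
    by (simp add: split_beta)
next
  fix x :: "real \<times> 'a"
  obtain N :: nat where N: "max 0 (fst x) \<le> real N"
    using real_arch_simple by blast
  have "\<forall>\<^sub>F n in sequentially. min (real n) (max 0 (fst x)) = max 0 (fst x)"
  proof (rule eventually_sequentiallyI[of N])
    fix n assume "N \<le> n"
    then have "real N \<le> real n" by simp
    then show "min (real n) (max 0 (fst x)) = max 0 (fst x)"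
      using N by linarith
  qed
  then show "(\<lambda>n. case x of (s, \<omega>) \<Rightarrow> \<alpha> (min (real n) (max 0 s)) \<omega>) \<longlonglongrightarrow> (case x of (s, \<omega>) \<Rightarrow> \<alpha> (max 0 s) \<omega>)"
    by (intro tendsto_eventually) (auto simp: split_beta elim!: eventually_mono)
qed

lemma drift_measurable_F:
  assumes "\<alpha> \<in> controls F" "t \<ge> 0"
  shows "drift \<alpha> t \<in> borel_measurable (F t)"
proof -
  have "(\<lambda>(\<omega>, u). \<alpha> (min t (max 0 u)) \<omega>) \<in> borel_measurable (F t \<Otimes>\<^sub>M borel)"
    using measurable_compose[OF measurable_pair_swap' control_measurable_clamped[OF assms]]
    by (simp add: split_beta)
  then have [measurable]: "(\<lambda>(\<omega>, u). \<alpha> (min t (max 0 u)) \<omega>) \<in> borel_measurable (F t \<Otimes>\<^sub>M lborel)"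
    by (simp cong: measurable_cong_sets)
  have "(\<lambda>\<omega>. \<integral>u. indicator {0..t} u *\<^sub>R \<alpha> (min t (max 0 u)) \<omega> \<partial>lborel) \<in> borel_measurable (F t)"
    by measurable
  also have "(\<lambda>\<omega>. \<integral>u. indicator {0..t} u *\<^sub>R \<alpha> (min t (max 0 u)) \<omega> \<partial>lborel) = drift \<alpha> t"
    unfolding drift_def set_lebesgue_integral_def
    by (intro ext Bochner_Integration.integral_cong) (auto split: split_indicator)
  finally show ?thesis .
qed

lemma drift_measurable:
  assumes "\<alpha> \<in> controls F"
  shows "(\<lambda>(t, \<omega>). drift \<alpha> t \<omega>) \<in> borel_measurable (borel \<Otimes>\<^sub>M M)"
proof -
  have [measurable]: "(\<lambda>p. \<alpha> (max 0 (snd p)) (snd (fst p)))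
      \<in> borel_measurable ((borel \<Otimes>\<^sub>M M) \<Otimes>\<^sub>M (lborel :: real measure))"
    using measurable_compose[OF _ control_measurable[OF assms],
        of "\<lambda>p. (snd p, snd (fst p))" "(borel \<Otimes>\<^sub>M M) \<Otimes>\<^sub>M (lborel :: real measure)"]
    by simp
  have "(\<lambda>p. \<integral>u. (if 0 \<le> u \<and> u \<le> fst p then 1 else 0) *\<^sub>R \<alpha> (max 0 u) (snd p) \<partial>lborel)
      \<in> borel_measurable (borel \<Otimes>\<^sub>M M)"
    by measurable
  also have "(\<lambda>p. \<integral>u. (if 0 \<le> u \<and> u \<le> fst p then 1 else 0) *\<^sub>R \<alpha> (max 0 u) (snd p) \<partial>lborel)
      = (\<lambda>(t, \<omega>). drift \<alpha> t \<omega>)"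
    unfolding drift_def set_lebesgue_integral_def split_beta
    by (intro ext Bochner_Integration.integral_cong) (auto split: split_indicator)
  finally show ?thesis .
qed

text \<open>Off a null set of paths the Brownian motion is continuous in time, and a process with
  continuous paths is jointly measurable.\<close>

lemma brownian_version_measurable:
  obtains B' :: "real \<Rightarrow> 'a \<Rightarrow> real" where "(\<lambda>(t, \<omega>). B' t \<omega>) \<in> borel_measurable (borel \<Otimes>\<^sub>M M)"
    and "AE \<omega> in M. \<forall>t\<ge>0. B' t \<omega> = B t \<omega>"
proof -
  from AE_E[OF continuous_B] obtain N
    where N: "{\<omega> \<in> space M. \<not> continuous_on {0..} (\<lambda>t. B t \<omega>)} \<subseteq> N" "N \<in> null_sets M"
    by (metis null_setsI)
  define G where "G = space M - N"
  have G [measurable]: "G \<in> sets M" using N unfolding G_def by auto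
  define B' where "B' t \<omega> = indicator G \<omega> * B (max 0 t) \<omega>" for t \<omega>
  have [measurable]: "B' t \<in> borel_measurable M" for t
  proof -
    have [measurable]: "B (max 0 t) \<in> borel_measurable M"
      by (rule measurable_F[OF _ adapted_B]) auto
    show ?thesis unfolding B'_def by measurable
  qed
  have cont: "continuous_on UNIV (\<lambda>t. B' t \<omega>)" if "\<omega> \<in> space M" for \<omega>
  proof (cases "\<omega> \<in> G")
    case True
    then have "continuous_on {0..} (\<lambda>t. B t \<omega>)" using N(1) that by (auto simp: G_def)
    then have "continuous_on UNIV (\<lambda>t. B (max 0 t) \<omega>)"
      by (rule continuous_on_compose2) (auto intro!: continuous_intros)
    then show ?thesis using True by (simp add: B'_def)
  qed (simp add: B'_def)
  \<comment> \<open>\<open>B'\<close> is the limit of its samples at dyadic times, which are countably many.\<close>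
  have "(\<lambda>(t, \<omega>). B' t \<omega>) \<in> borel_measurable (borel \<Otimes>\<^sub>M M)"
  proof (rule borel_measurable_LIMSEQ_real)
    fix n :: nat
    show "(\<lambda>p. B' (of_int \<lfloor>fst p * (2::real)^n\<rfloor> / 2^n) (snd p)) \<in> borel_measurable (borel \<Otimes>\<^sub>M M)"
      by (rule measurable_compose_countable[where g="\<lambda>p. \<lfloor>fst p * (2::real)^n\<rfloor>"]) measurable
  next
    fix p :: "real \<times> 'a" assume "p \<in> space (borel \<Otimes>\<^sub>M M)"
    then obtain t \<omega> where p: "p = (t, \<omega>)" "\<omega> \<in> space M" by (auto simp: space_pair_measure)
    have "(\<lambda>n. of_int \<lfloor>t * 2^n\<rfloor> / 2^n) \<longlonglongrightarrow> t"
    proof (rule tendsto_sandwich[where f="\<lambda>n. t - (1/2)^n" and h="\<lambda>n. t"])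
      have "t - (1/2)^n \<le> of_int \<lfloor>t * 2^n\<rfloor> / 2^n" for n
      proof -
        have "t * 2^n - 1 \<le> of_int \<lfloor>t * 2^n\<rfloor>" by linarith
        then have "(t * 2^n - 1) / 2^n \<le> of_int \<lfloor>t * 2^n\<rfloor> / 2^n"
          by (intro divide_right_mono) auto
        then show ?thesis by (simp add: diff_divide_distrib power_divide)
      qed
      then show "\<forall>\<^sub>F n in sequentially. t - (1/2)^n \<le> of_int \<lfloor>t * 2^n\<rfloor> / 2^n" by simp
      have "of_int \<lfloor>t * 2^n\<rfloor> / 2^n \<le> t" for n
        by (simp add: field_simps)
      then show "\<forall>\<^sub>F n in sequentially. of_int \<lfloor>t * 2^n\<rfloor> / 2^n \<le> t" by simp
      show "(\<lambda>n. t - (1/2)^n) \<longlonglongrightarrow> t"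
        using tendsto_diff[OF tendsto_const LIMSEQ_power_zero[of "1/2::real"], of t] by simp
    qed auto
    then show "(\<lambda>n. B' (of_int \<lfloor>fst p * 2^n\<rfloor> / 2^n) (snd p)) \<longlonglongrightarrow> (case p of (t, \<omega>) \<Rightarrow> B' t \<omega>)"
      using continuous_on_tendsto_compose[OF cont[OF p(2)], of _ t sequentially] p by simp
  qed
  moreover have "AE \<omega> in M. \<forall>t\<ge>0. B' t \<omega> = B t \<omega>"
    using AE_not_in[OF N(2)] AE_space by eventually_elim (auto simp: B'_def G_def)
  ultimately show thesis by (rule that)
qed

end

section \<open>The cost as a double integral\<close>

lemma ext_integral_cong_AE:
  assumes "AE x in N. f x = g x"
  shows "ext_integral N f = ext_integral N g"
  unfolding ext_integral_def
  by (intro arg_cong2[of _ _ _ _ minus] arg_cong[of _ _ enn2ereal] nn_integral_cong_AE)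
     (use assms in \<open>auto elim: eventually_mono\<close>)

text \<open>The extended integral of a function that is bounded below by an integrable function is
  a nonnegative integral up to a finite constant.  This is what reduces statements about the cost
  to statements about nonnegative integrals, where Fubini and monotonicity hold without
  integrability conditions.\<close>

lemma ext_integral_diff:
  assumes [measurable]: "f \<in> borel_measurable N" and b: "integrable N b" "\<And>x. b x \<ge> 0"
  shows "ext_integral N (\<lambda>x. enn2ereal (f x) - ereal (b x))
    = enn2ereal (\<integral>\<^sup>+x. f x \<partial>N) - ereal (\<integral>x. b x \<partial>N)"
proof -
  have [measurable]: "b \<in> borel_measurable N" using b by auto
  define p where "p = (\<integral>\<^sup>+x. f x - ennreal (b x) \<partial>N)"
  define m where "m = (\<integral>\<^sup>+x. ennreal (b x) - f x \<partial>N)"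
  have pm: "ext_integral N (\<lambda>x. enn2ereal (f x) - ereal (b x)) = enn2ereal p - enn2ereal m"
  proof -
    have 1: "e2ennreal (enn2ereal (f x) - ereal (b x)) = f x - ennreal (b x)" for x
      using b(2)[of x] by (cases "f x") (auto simp: ennreal_minus e2ennreal_ereal top_ereal_def e2ennreal_infty)
    have 2: "e2ennreal (- (enn2ereal (f x) - ereal (b x))) = ennreal (b x) - f x" for x
      using b(2)[of x] by (cases "f x") (auto simp: ennreal_minus e2ennreal_ereal top_ereal_def e2ennreal_neg)
    show ?thesis
      by (simp add: ext_integral_def 1 2 p_def m_def)
  qed
  have bint: "(\<integral>\<^sup>+x. ennreal (b x) \<partial>N) = ennreal (\<integral>x. b x \<partial>N)"
    using b by (intro nn_integral_eq_integral) auto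
  \<comment> \<open>Both sides of the pointwise identity below are \<open>max (f x) (b x)\<close>.\<close>
  have "p + (\<integral>\<^sup>+x. ennreal (b x) \<partial>N) = (\<integral>\<^sup>+x. (f x - ennreal (b x)) + ennreal (b x) \<partial>N)"
    unfolding p_def by (rule nn_integral_add[symmetric]) measurable
  also have "\<dots> = (\<integral>\<^sup>+x. f x + (ennreal (b x) - f x) \<partial>N)"
  proof (rule nn_integral_cong)
    fix x show "(f x - ennreal (b x)) + ennreal (b x) = f x + (ennreal (b x) - f x)"
      by (metis add.commute add_diff_self_ennreal ennreal_add_diff_cancel_left less_eq_ennreal_def linorder_le_cases diff_add_self_ennreal diff_eq_0_iff_ennreal)
  qed
  also have "\<dots> = (\<integral>\<^sup>+x. f x \<partial>N) + m"
    unfolding m_def by (rule nn_integral_add) measurable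
  finally have eq: "p + ennreal (\<integral>x. b x \<partial>N) = (\<integral>\<^sup>+x. f x \<partial>N) + m"
    by (simp add: bint)
  have "m \<le> (\<integral>\<^sup>+x. ennreal (b x) \<partial>N)"
    unfolding m_def by (intro nn_integral_mono) (auto simp: diff_le_self_ennreal)
  then have "m < \<top>"
    unfolding bint by (rule le_less_trans) simp
  then obtain m' where m': "m = ennreal m'" "m' \<ge> 0"
    by (metis ennreal_cases less_irrefl)
  have b': "0 \<le> (\<integral>x. b x \<partial>N)" using b(2) by simp
  have "enn2ereal p + ereal (\<integral>x. b x \<partial>N) = enn2ereal (\<integral>\<^sup>+x. f x \<partial>N) + ereal m'"
    using arg_cong[OF eq, of enn2ereal] m' b' by (simp add: plus_ennreal.rep_eq)
  then have "enn2ereal p - ereal m' = enn2ereal (\<integral>\<^sup>+x. f x \<partial>N) - ereal (\<integral>x. b x \<partial>N)"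
    by (cases "enn2ereal p"; cases "enn2ereal (\<integral>\<^sup>+x. f x \<partial>N)") auto
  then show ?thesis
    using m' by (simp add: pm)
qed

lemma nn_integral_exp_atLeast:
  fixes \<beta> a :: real
  assumes "\<beta> > 0"
  shows "(\<integral>\<^sup>+t. ennreal (exp (- \<beta> * t)) * indicator {a..} t \<partial>lborel) = ennreal (exp (- \<beta> * a) / \<beta>)"
proof -
  have exp_decay: "((\<lambda>t. exp (- \<beta> * t)) \<longlongrightarrow> 0) at_top"
    using assms
    by (intro filterlim_compose[OF exp_at_bot] filterlim_tendsto_neg_mult_at_bot[OF tendsto_const]
        filterlim_ident) auto
  have "(\<integral>\<^sup>+t. ennreal (exp (- \<beta> * t)) * indicator {a..} t \<partial>lborel)
      = ennreal (0 - (- (exp (- \<beta> * a) / \<beta>)))"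
  proof (rule nn_integral_FTC_atLeast[where F="\<lambda>t. - (exp (- \<beta> * t) / \<beta>)"])
    show "((\<lambda>t. - (exp (- \<beta> * t) / \<beta>)) \<longlongrightarrow> 0) at_top"
      using tendsto_minus[OF tendsto_divide[OF exp_decay tendsto_const]] assms by fastforce
  qed (use assms in \<open>auto intro!: derivative_eq_intros\<close>)
  then show ?thesis by simp
qed

lemma time_integral_exp:
  assumes "\<beta> > 0"
  shows "integrable time (\<lambda>t. exp (- \<beta> * t))" "(\<integral>t. exp (- \<beta> * t) \<partial>time) = 1 / \<beta>"
proof -
  have "(\<integral>\<^sup>+t. ennreal (exp (- \<beta> * t)) \<partial>time) = ennreal (1 / \<beta>)"
    using nn_integral_exp_atLeast[OF assms, of 0] by (simp add: nn_integral_restrict_space)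
  then have "integrable time (\<lambda>t. exp (- \<beta> * t)) \<and> (\<integral>t. exp (- \<beta> * t) \<partial>time) = 1 / \<beta>"
    using assms by (subst (asm) nn_integral_eq_integrable) (auto intro!: measurable_restrict_space1)
  then show "integrable time (\<lambda>t. exp (- \<beta> * t))" "(\<integral>t. exp (- \<beta> * t) \<partial>time) = 1 / \<beta>"
    by auto
qed

text \<open>The discount factor is absorbed into the time measure, which thereby becomes finite.\<close>

definition discounted_time :: "real \<Rightarrow> real measure" where
  "discounted_time \<beta> = density time (\<lambda>t. ennreal (exp (- \<beta> * t)))"

lemma space_discounted_time [simp]: "space (discounted_time \<beta>) = {0..}"
  by (simp add: discounted_time_def)

lemma sets_discounted_time: "sets (discounted_time \<beta>) = sets (restrict_space borel {0..})"
  by (simp add: discounted_time_def sets_restrict_space)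

lemma nn_integral_discounted_time:
  assumes "f \<in> borel_measurable time"
  shows "(\<integral>\<^sup>+t. f t \<partial>discounted_time \<beta>) = (\<integral>\<^sup>+t. ennreal (exp (- \<beta> * t)) * f t \<partial>time)"
  unfolding discounted_time_def
  by (rule nn_integral_density) (use assms in \<open>auto intro!: measurable_restrict_space1\<close>)

lemma finite_measure_discounted_time:
  assumes "\<beta> > 0"
  shows "finite_measure (discounted_time \<beta>)"
proof
  have "emeasure (discounted_time \<beta>) (space (discounted_time \<beta>)) = (\<integral>\<^sup>+t. 1 \<partial>discounted_time \<beta>)"
    by simp
  also have "\<dots> = ennreal (1 / \<beta>)"
    using nn_integral_exp_atLeast[OF assms, of 0]
    by (subst nn_integral_discounted_time) (auto simp: nn_integral_restrict_space)
  finally show "emeasure (discounted_time \<beta>) (space (discounted_time \<beta>)) \<noteq> \<infinity>"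
    by simp
qed

definition circular_mean :: "(real \<Rightarrow> torus measure) \<Rightarrow> real \<Rightarrow> complex" where
  "circular_mean \<mu> t = (\<integral>x. torus_char 1 x \<partial>\<mu> t)"

lemma integrable_torus_char:
  assumes "\<nu> \<in> borel_probs"
  shows "integrable \<nu> (torus_char k)"
proof -
  interpret prob_space \<nu> using assms by (simp add: borel_probs_def)
  show ?thesis
    using assms by (intro integrable_const_bound[of _ 1])
      (auto simp: borel_probs_def cong: measurable_cong_sets)
qed

lemma norm_circular_mean_le:
  assumes "\<mu> t \<in> borel_probs"
  shows "norm (circular_mean \<mu> t) \<le> 1"
proof -
  interpret prob_space "\<mu> t" using assms by (simp add: borel_probs_def)
  have "norm (circular_mean \<mu> t) \<le> (\<integral>x. norm (torus_char 1 x) \<partial>\<mu> t)"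
    unfolding circular_mean_def by (rule integral_norm_bound)
  then show ?thesis by (simp add: prob_space)
qed

lemma Re_torus_char: "Re (torus_char 1 x) = torus_cos x"
  by transfer simp

lemma Im_torus_char: "Im (torus_char 1 x) = torus_sin x"
  by transfer simp

lemma interaction_cost_to_torus:
  assumes "\<mu> t \<in> borel_probs"
  shows "interaction_cost \<kappa> \<mu> t (to_torus y) = - \<kappa> * Re (cnj (circular_mean \<mu> t) * cis y)"
proof -
  note int = integrable_torus_char[OF assms, of 1]
  have "Re (circular_mean \<mu> t) = (\<integral>x. torus_cos x \<partial>\<mu> t)"
    unfolding circular_mean_def integral_Re[OF int, symmetric]
    by (simp add: Re_torus_char)
  moreover have "Im (circular_mean \<mu> t) = (\<integral>x. torus_sin x \<partial>\<mu> t)"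
    unfolding circular_mean_def integral_Im[OF int, symmetric]
    by (simp add: Im_torus_char)
  ultimately show ?thesis
    by (simp add: interaction_cost_def algebra_simps)
qed

locale kuramoto_game = brownian_motion M F B
  for M :: "'a measure" and F :: "real \<Rightarrow> 'a measure" and B :: "real \<Rightarrow> 'a \<Rightarrow> real" +
  fixes \<beta> \<sigma> \<kappa> :: real and X\<^sub>0 :: "'a \<Rightarrow> torus" and \<mu> :: "real \<Rightarrow> torus measure"
  assumes beta_pos: "\<beta> > 0" and sigma_pos: "\<sigma> > 0" and kappa_pos: "\<kappa> > 0"
    and X0_measurable: "X\<^sub>0 \<in> F 0 \<rightarrow>\<^sub>M borel"
    and flow_probs: "t \<ge> 0 \<Longrightarrow> \<mu> t \<in> borel_probs"
begin

text \<open>A real-valued lift of the state.  It is adapted because the torus has a measurable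
  section.\<close>

definition path :: "(real \<Rightarrow> 'a \<Rightarrow> real) \<Rightarrow> real \<Rightarrow> 'a \<Rightarrow> real" where
  "path \<alpha> t \<omega> = torus_arg (X\<^sub>0 \<omega>) + drift \<alpha> t \<omega> + \<sigma> * B t \<omega>"

lemma state_eq_path: "state B \<sigma> X\<^sub>0 \<alpha> t \<omega> = to_torus (path \<alpha> t \<omega>)"
proof -
  have "X\<^sub>0 \<omega> + to_torus y = to_torus (torus_arg (X\<^sub>0 \<omega>) + y)" for y
    by (metis to_torus_add to_torus_torus_arg)
  then show ?thesis
    by (simp add: state_def path_def drift_def add.assoc)
qed

lemma X0_measurable_F: "t \<ge> 0 \<Longrightarrow> X\<^sub>0 \<in> F t \<rightarrow>\<^sub>M borel"
  using X0_measurable sets_F_mono[of 0 t] by (auto simp: measurable_def space_F)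

lemma path_measurable_F:
  assumes "\<alpha> \<in> controls F" "t \<ge> 0"
  shows "path \<alpha> t \<in> borel_measurable (F t)"
proof -
  note [measurable] = drift_measurable_F[OF assms] adapted_B[OF assms(2)] X0_measurable_F[OF assms(2)]
  show ?thesis unfolding path_def by measurable
qed

text \<open>Fubini's theorem needs a jointly measurable path, which is available only after a
  modification on a null set; hence the version \<open>P\<close> of the path here and below.\<close>

lemma path_version_measurable:
  assumes "\<alpha> \<in> controls F"
  obtains P :: "real \<Rightarrow> 'a \<Rightarrow> real"
  where "(\<lambda>(t, \<omega>). P t \<omega>) \<in> borel_measurable (borel \<Otimes>\<^sub>M M)"
    and "AE \<omega> in M. \<forall>t\<ge>0. P t \<omega> = path \<alpha> t \<omega>"
proof -
  obtain B' :: "real \<Rightarrow> 'a \<Rightarrow> real"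
    where [measurable]: "(\<lambda>(t, \<omega>). B' t \<omega>) \<in> borel_measurable (borel \<Otimes>\<^sub>M M)"
    and B': "AE \<omega> in M. \<forall>t\<ge>0. B' t \<omega> = B t \<omega>"
    by (rule brownian_version_measurable)
  note [measurable] = drift_measurable[OF assms] measurable_F[OF order_refl X0_measurable]
  show thesis
  proof (rule that[of "\<lambda>t \<omega>. torus_arg (X\<^sub>0 \<omega>) + drift \<alpha> t \<omega> + \<sigma> * B' t \<omega>"])
    show "AE \<omega> in M. \<forall>t\<ge>0. torus_arg (X\<^sub>0 \<omega>) + drift \<alpha> t \<omega> + \<sigma> * B' t \<omega> = path \<alpha> t \<omega>"
      using B' by eventually_elim (simp add: path_def)
  qed measurable
qed

abbreviation occupation :: "(real \<times> 'a) measure" where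
  "occupation \<equiv> discounted_time \<beta> \<Otimes>\<^sub>M M"

lemma measurable_occupation:
  assumes "f \<in> borel_measurable (borel \<Otimes>\<^sub>M M)"
  shows "f \<in> borel_measurable occupation"
proof -
  have "(\<lambda>p. (fst p, snd p)) \<in> occupation \<rightarrow>\<^sub>M (borel \<Otimes>\<^sub>M M)"
  proof (intro measurable_Pair)
    have "(\<lambda>t. t) \<in> discounted_time \<beta> \<rightarrow>\<^sub>M borel"
      by (simp add: measurable_restrict_space1 cong: measurable_cong_sets[OF sets_discounted_time])
    then show "fst \<in> occupation \<rightarrow>\<^sub>M borel"
      using measurable_compose[OF measurable_fst] by blast
  qed measurable
  from measurable_compose[OF this assms] show ?thesis by simp
qed

lemma control_measurable_occupation:
  assumes "\<alpha> \<in> controls F"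
  shows "(\<lambda>p. \<alpha> (fst p) (snd p)) \<in> borel_measurable occupation"
proof -
  have "(\<lambda>p. \<alpha> (max 0 (fst p)) (snd p)) \<in> borel_measurable occupation"
    using measurable_occupation[OF control_measurable[OF assms]] by (simp add: split_beta)
  then show ?thesis
    by (subst measurable_cong[where g="\<lambda>p. \<alpha> (max 0 (fst p)) (snd p)"])
       (auto simp: space_pair_measure)
qed

lemma pair_sigma_finite_occupation: "pair_sigma_finite (discounted_time \<beta>) M"
proof -
  interpret T: finite_measure "discounted_time \<beta>"
    by (rule finite_measure_discounted_time[OF beta_pos])
  show ?thesis by unfold_locales
qed

text \<open>The integrand of the cost, with the lifted path \<open>P\<close> and the control \<open>a\<close> as separate
  arguments and shifted by \<open>\<kappa>\<close> to be nonnegative.\<close>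

definition running_cost :: "(real \<Rightarrow> 'a \<Rightarrow> real) \<Rightarrow> (real \<Rightarrow> 'a \<Rightarrow> real) \<Rightarrow> real \<times> 'a \<Rightarrow> real" where
  "running_cost P a p = \<kappa> - \<kappa> * Re (cnj (circular_mean \<mu> (fst p)) * cis (P (fst p) (snd p)))
     + (a (fst p) (snd p))\<^sup>2 / 2"

lemma running_cost_bounds:
  assumes "p \<in> space occupation"
  shows "(a (fst p) (snd p))\<^sup>2 / 2 \<le> running_cost P a p"
    and "running_cost P a p \<le> 2 * \<kappa> + (a (fst p) (snd p))\<^sup>2 / 2"
proof -
  have "fst p \<ge> 0" using assms by (auto simp: space_pair_measure)
  define z where "z = cnj (circular_mean \<mu> (fst p)) * cis (P (fst p) (snd p))"
  have "norm z \<le> 1"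
    using norm_circular_mean_le[of \<mu>, OF flow_probs[OF \<open>fst p \<ge> 0\<close>]] by (simp add: z_def norm_mult)
  then have "\<bar>Re z\<bar> \<le> 1"
    using abs_Re_le_cmod[of z] by linarith
  then have "\<bar>\<kappa> * Re z\<bar> \<le> \<kappa>"
    using kappa_pos by (simp add: abs_mult)
  then show "(a (fst p) (snd p))\<^sup>2 / 2 \<le> running_cost P a p"
    and "running_cost P a p \<le> 2 * \<kappa> + (a (fst p) (snd p))\<^sup>2 / 2"
    unfolding running_cost_def z_def[symmetric] by linarith+
qed

lemma running_cost_measurable:
  assumes P: "(\<lambda>(t, \<omega>). P t \<omega>) \<in> borel_measurable (borel \<Otimes>\<^sub>M M)" and a: "a \<in> controls F"
    and m: "circular_mean \<mu> \<in> borel_measurable (discounted_time \<beta>)"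
  shows "running_cost P a \<in> borel_measurable occupation"
proof -
  have [measurable]: "(\<lambda>p. P (fst p) (snd p)) \<in> borel_measurable occupation"
    using measurable_occupation[OF P] by (simp add: split_beta)
  note [measurable] = control_measurable_occupation[OF a]
  have [measurable]: "(\<lambda>p. circular_mean \<mu> (fst p)) \<in> borel_measurable occupation"
    using m by measurable
  show ?thesis
    unfolding running_cost_def by measurable
qed

text \<open>The shift of the running cost by \<open>\<kappa>\<close> contributes \<open>\<kappa> / \<beta>\<close>, the total discounted
  mass times \<open>\<kappa>\<close>, which is subtracted again.\<close>

lemma cost_eq_occupation:
  assumes \<alpha>: "\<alpha> \<in> controls F"
    and m: "circular_mean \<mu> \<in> borel_measurable (discounted_time \<beta>)"
    and P: "(\<lambda>(t, \<omega>). P t \<omega>) \<in> borel_measurable (borel \<Otimes>\<^sub>M M)"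
    and AE_P: "AE \<omega> in M. \<forall>t\<ge>0. P t \<omega> = path \<alpha> t \<omega>"
  shows "cost M B \<beta> \<sigma> \<kappa> \<mu> X\<^sub>0 \<alpha> =
    enn2ereal (\<integral>\<^sup>+p. ennreal (running_cost P \<alpha> p) \<partial>occupation) - ereal (\<kappa> / \<beta>)"
proof -
  have rc_meas [measurable]: "running_cost P \<alpha> \<in> borel_measurable occupation"
    by (rule running_cost_measurable[OF P \<alpha> m])
  have rc_time: "(\<lambda>t. running_cost P \<alpha> (t, \<omega>)) \<in> borel_measurable time" if "\<omega> \<in> space M" for \<omega>
    using measurable_compose[OF measurable_Pair2'[OF that, of "discounted_time \<beta>"] rc_meas]
    by (simp add: discounted_time_def)
  have rc_nonneg: "0 \<le> running_cost P \<alpha> (t, \<omega>)" if "t \<ge> 0" "\<omega> \<in> space M" for t \<omega>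
  proof -
    have "0 \<le> (\<alpha> t \<omega>)\<^sup>2 / 2" by simp
    also have "\<dots> \<le> running_cost P \<alpha> (t, \<omega>)"
      using running_cost_bounds(1)[of "(t, \<omega>)"] that by (simp add: space_pair_measure)
    finally show ?thesis .
  qed
  define I where "I \<omega> = (\<integral>\<^sup>+t. ennreal (running_cost P \<alpha> (t, \<omega>)) \<partial>discounted_time \<beta>)" for \<omega>
  interpret pair_sigma_finite "discounted_time \<beta>" M
    by (rule pair_sigma_finite_occupation)
  have [measurable]: "(\<lambda>p. running_cost P \<alpha> (snd p, fst p)) \<in> borel_measurable (M \<Otimes>\<^sub>M discounted_time \<beta>)"
    using measurable_compose[OF measurable_pair_swap' rc_meas] by (simp add: split_beta)
  have I_meas [measurable]: "I \<in> borel_measurable M"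
    unfolding I_def by measurable
  have "AE \<omega> in M. ext_integral time (\<lambda>t. ereal (exp (- \<beta> * t) *
         (interaction_cost \<kappa> \<mu> t (state B \<sigma> X\<^sub>0 \<alpha> t \<omega>) + (\<alpha> t \<omega>)\<^sup>2 / 2)))
      = enn2ereal (I \<omega>) - ereal (\<kappa> / \<beta>)"
    using AE_P AE_space
  proof eventually_elim
    case (elim \<omega>)
    have "ext_integral time (\<lambda>t. ereal (exp (- \<beta> * t) *
         (interaction_cost \<kappa> \<mu> t (state B \<sigma> X\<^sub>0 \<alpha> t \<omega>) + (\<alpha> t \<omega>)\<^sup>2 / 2)))
      = ext_integral time (\<lambda>t. enn2ereal (ennreal (exp (- \<beta> * t)) * ennreal (running_cost P \<alpha> (t, \<omega>))) - ereal (\<kappa> * exp (- \<beta> * t)))"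
    proof (rule ext_integral_cong_AE, rule AE_I2)
      fix t :: real assume "t \<in> space time"
      then have t: "t \<ge> 0" by simp
      have "exp (- \<beta> * t) * (interaction_cost \<kappa> \<mu> t (state B \<sigma> X\<^sub>0 \<alpha> t \<omega>) + (\<alpha> t \<omega>)\<^sup>2 / 2)
        = exp (- \<beta> * t) * running_cost P \<alpha> (t, \<omega>) - \<kappa> * exp (- \<beta> * t)"
        using elim(1) t
        by (simp add: state_eq_path interaction_cost_to_torus[of \<mu>, OF flow_probs] running_cost_def algebra_simps)
      then show "ereal (exp (- \<beta> * t) * (interaction_cost \<kappa> \<mu> t (state B \<sigma> X\<^sub>0 \<alpha> t \<omega>) + (\<alpha> t \<omega>)\<^sup>2 / 2))
        = enn2ereal (ennreal (exp (- \<beta> * t)) * ennreal (running_cost P \<alpha> (t, \<omega>))) - ereal (\<kappa> * exp (- \<beta> * t))"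
        using rc_nonneg[OF t elim(2)] by (simp flip: ennreal_mult)
    qed
    also have "\<dots> = enn2ereal (\<integral>\<^sup>+t. ennreal (exp (- \<beta> * t)) * ennreal (running_cost P \<alpha> (t, \<omega>)) \<partial>time)
        - ereal (\<integral>t. \<kappa> * exp (- \<beta> * t) \<partial>time)"
      using rc_time[OF elim(2)] time_integral_exp(1)[OF beta_pos] kappa_pos
      by (intro ext_integral_diff) (auto intro!: measurable_restrict_space1)
    also have "(\<integral>t. \<kappa> * exp (- \<beta> * t) \<partial>time) = \<kappa> / \<beta>"
      using time_integral_exp[OF beta_pos] by simp
    also have "(\<integral>\<^sup>+t. ennreal (exp (- \<beta> * t)) * ennreal (running_cost P \<alpha> (t, \<omega>)) \<partial>time) = I \<omega>"
      unfolding I_def using rc_time[OF elim(2)] by (subst nn_integral_discounted_time) auto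
    finally show ?case .
  qed
  then have "cost M B \<beta> \<sigma> \<kappa> \<mu> X\<^sub>0 \<alpha> = ext_integral M (\<lambda>\<omega>. enn2ereal (I \<omega>) - ereal (\<kappa> / \<beta>))"
    unfolding cost_def by (rule ext_integral_cong_AE)
  also have "\<dots> = enn2ereal (\<integral>\<^sup>+\<omega>. I \<omega> \<partial>M) - ereal (\<integral>\<omega>. \<kappa> / \<beta> \<partial>M)"
    using beta_pos kappa_pos by (intro ext_integral_diff) auto
  also have "(\<integral>\<omega>. \<kappa> / \<beta> \<partial>M) = \<kappa> / \<beta>"
    by (simp add: prob_space)
  also have "(\<integral>\<^sup>+\<omega>. I \<omega> \<partial>M) = (\<integral>\<^sup>+p. ennreal (running_cost P \<alpha> p) \<partial>occupation)"
    unfolding I_def using nn_integral_snd[of "\<lambda>p. ennreal (running_cost P \<alpha> p)"] by simp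
  finally show ?thesis .
qed

end

section \<open>The variational inequality\<close>

lemma norm_cis_diff_le: "norm (cis x - cis y) \<le> \<bar>x - y\<bar>"
proof -
  have "cis x - cis y = cis y * (cis (x - y) - 1)"
    by (simp add: algebra_simps cis_mult)
  then have "norm (cis x - cis y) = norm (cis (x - y) - 1)"
    by (simp add: norm_mult)
  also have "\<dots> \<le> \<bar>x - y\<bar>"
    using iexp_approx1[of "x - y" 0] by (simp add: cis_conv_exp)
  finally show ?thesis .
qed

lemma (in prob_space) norm_expectation_cis_le: "norm (expectation (\<lambda>\<omega>. cis (f \<omega>))) \<le> 1"
proof -
  have "norm (expectation (\<lambda>\<omega>. cis (f \<omega>))) \<le> expectation (\<lambda>\<omega>. norm (cis (f \<omega>)))"
    by (rule integral_norm_bound)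
  then show ?thesis by (simp add: prob_space)
qed

locale kuramoto_equilibrium = kuramoto_game M F B \<beta> \<sigma> \<kappa> X\<^sub>0 \<mu>
  for M :: "'a measure" and F :: "real \<Rightarrow> 'a measure" and B :: "real \<Rightarrow> 'a \<Rightarrow> real"
    and \<beta> \<sigma> \<kappa> :: real and X\<^sub>0 :: "'a \<Rightarrow> torus" and \<mu> :: "real \<Rightarrow> torus measure" +
  fixes \<alpha> :: "real \<Rightarrow> 'a \<Rightarrow> real"
  assumes control: "\<alpha> \<in> controls F"
    and optimal: "\<alpha>' \<in> controls F \<Longrightarrow> cost M B \<beta> \<sigma> \<kappa> \<mu> X\<^sub>0 \<alpha> \<le> cost M B \<beta> \<sigma> \<kappa> \<mu> X\<^sub>0 \<alpha>'"
    and consistent: "t \<ge> 0 \<Longrightarrow> \<mu> t = distr M borel (state B \<sigma> X\<^sub>0 \<alpha> t)"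
begin

lemma integral_torus_char_flow:
  assumes "t \<ge> 0"
  shows "(\<integral>x. torus_char k x \<partial>\<mu> t) = (\<integral>\<omega>. cis (of_int k * path \<alpha> t \<omega>) \<partial>M)"
proof -
  have [measurable]: "path \<alpha> t \<in> borel_measurable M"
    by (rule measurable_F[OF assms path_measurable_F[OF control assms]])
  have [measurable]: "state B \<sigma> X\<^sub>0 \<alpha> t \<in> M \<rightarrow>\<^sub>M borel"
    unfolding state_eq_path[abs_def] by measurable
  show ?thesis
    unfolding consistent[OF assms] by (subst integral_distr) (auto simp: state_eq_path)
qed

lemma circular_mean_eq: "t \<ge> 0 \<Longrightarrow> circular_mean \<mu> t = (\<integral>\<omega>. cis (path \<alpha> t \<omega>) \<partial>M)"
  using integral_torus_char_flow[of t 1] by (simp add: circular_mean_def)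

text \<open>A general flow need not be measurable in time, but the flow of laws of a process with
  a jointly measurable version is, by Fubini.\<close>

lemma circular_mean_measurable: "circular_mean \<mu> \<in> borel_measurable (discounted_time \<beta>)"
proof -
  obtain P :: "real \<Rightarrow> 'a \<Rightarrow> real"
    where [measurable]: "(\<lambda>(t, \<omega>). P t \<omega>) \<in> borel_measurable (borel \<Otimes>\<^sub>M M)"
    and P: "AE \<omega> in M. \<forall>t\<ge>0. P t \<omega> = path \<alpha> t \<omega>"
    by (rule path_version_measurable[OF control])
  have "(\<lambda>t. \<integral>\<omega>. cis (P t \<omega>) \<partial>M) \<in> borel_measurable borel"
    by measurable
  then have "(\<lambda>t. \<integral>\<omega>. cis (P t \<omega>) \<partial>M) \<in> borel_measurable (discounted_time \<beta>)"
    by (simp add: measurable_restrict_space1 cong: measurable_cong_sets[OF sets_discounted_time])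
  also have "(\<lambda>t. \<integral>\<omega>. cis (P t \<omega>) \<partial>M) \<in> borel_measurable (discounted_time \<beta>)
      \<longleftrightarrow> circular_mean \<mu> \<in> borel_measurable (discounted_time \<beta>)"
  proof (rule measurable_cong)
    fix t assume "t \<in> space (discounted_time \<beta>)"
    then have t: "t \<ge> 0" by simp
    have [measurable]: "path \<alpha> t \<in> borel_measurable M"
      by (rule measurable_F[OF t path_measurable_F[OF control t]])
    show "(\<integral>\<omega>. cis (P t \<omega>) \<partial>M) = circular_mean \<mu> t"
      unfolding circular_mean_eq[OF t]
      by (intro integral_cong_AE) (use P t in \<open>auto elim: eventually_mono\<close>)
  qed
  finally show ?thesis .
qed

lemma optimal_running_cost:
  assumes "(\<lambda>(t, \<omega>). P t \<omega>) \<in> borel_measurable (borel \<Otimes>\<^sub>M M)" "AE \<omega> in M. \<forall>t\<ge>0. P t \<omega> = path \<alpha> t \<omega>"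
    and "(\<lambda>(t, \<omega>). P' t \<omega>) \<in> borel_measurable (borel \<Otimes>\<^sub>M M)" "AE \<omega> in M. \<forall>t\<ge>0. P' t \<omega> = path a t \<omega>"
    and "a \<in> controls F"
  shows "(\<integral>\<^sup>+p. running_cost P \<alpha> p \<partial>occupation) \<le> (\<integral>\<^sup>+p. running_cost P' a p \<partial>occupation)"
proof -
  have "enn2ereal (\<integral>\<^sup>+p. running_cost P \<alpha> p \<partial>occupation) - ereal (\<kappa> / \<beta>)
      \<le> enn2ereal (\<integral>\<^sup>+p. running_cost P' a p \<partial>occupation) - ereal (\<kappa> / \<beta>)"
    using optimal[OF assms(5)]
    unfolding cost_eq_occupation[OF control circular_mean_measurable assms(1,2)]
      cost_eq_occupation[OF assms(5) circular_mean_measurable assms(3,4)] .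
  then have "enn2ereal (\<integral>\<^sup>+p. running_cost P \<alpha> p \<partial>occupation)
      \<le> enn2ereal (\<integral>\<^sup>+p. running_cost P' a p \<partial>occupation)"
    by (cases "enn2ereal (\<integral>\<^sup>+p. running_cost P \<alpha> p \<partial>occupation)";
        cases "enn2ereal (\<integral>\<^sup>+p. running_cost P' a p \<partial>occupation)") auto
  then show ?thesis by (simp add: less_eq_ennreal.rep_eq)
qed

lemma finite_measure_occupation: "finite_measure occupation"
  by (intro finite_measure_pair_measure finite_measure_discounted_time beta_pos) unfold_locales

text \<open>The optimal control is at least as good as doing nothing, whose cost is finite.\<close>

lemma integrable_control_square: "integrable occupation (\<lambda>p. (\<alpha> (fst p) (snd p))\<^sup>2)"
proof -
  interpret occ: finite_measure occupation by (rule finite_measure_occupation)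
  have zero: "(\<lambda>t \<omega>. 0) \<in> controls F" by (simp add: controls_def)
  obtain P :: "real \<Rightarrow> 'a \<Rightarrow> real"
    where P: "(\<lambda>(t, \<omega>). P t \<omega>) \<in> borel_measurable (borel \<Otimes>\<^sub>M M)"
      "AE \<omega> in M. \<forall>t\<ge>0. P t \<omega> = path \<alpha> t \<omega>"
    by (rule path_version_measurable[OF control])
  obtain P' :: "real \<Rightarrow> 'a \<Rightarrow> real"
    where P': "(\<lambda>(t, \<omega>). P' t \<omega>) \<in> borel_measurable (borel \<Otimes>\<^sub>M M)"
      "AE \<omega> in M. \<forall>t\<ge>0. P' t \<omega> = path (\<lambda>t \<omega>. 0) t \<omega>"
    by (rule path_version_measurable[OF zero])
  have "(\<integral>\<^sup>+p. ennreal ((\<alpha> (fst p) (snd p))\<^sup>2) \<partial>occupation) \<le> (\<integral>\<^sup>+p. 2 * running_cost P \<alpha> p \<partial>occupation)"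
    using running_cost_bounds(1)[of _ \<alpha> P] by (intro nn_integral_mono ennreal_leI) (simp add: field_simps)
  also have "\<dots> = 2 * (\<integral>\<^sup>+p. running_cost P \<alpha> p \<partial>occupation)"
    using running_cost_measurable[OF P(1) control circular_mean_measurable]
    by (simp add: ennreal_mult' nn_integral_cmult)
  also have "\<dots> \<le> 2 * (\<integral>\<^sup>+p. running_cost P' (\<lambda>t \<omega>. 0) p \<partial>occupation)"
    by (intro mult_left_mono optimal_running_cost P P' zero) auto
  also have "\<dots> \<le> 2 * (\<integral>\<^sup>+p. ennreal (2 * \<kappa>) \<partial>occupation)"
    using running_cost_bounds(2)[where a="\<lambda>t \<omega>. 0" and P=P']
    by (intro mult_left_mono nn_integral_mono ennreal_leI) auto
  also have "\<dots> < \<infinity>"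
    using occ.emeasure_finite by (auto simp: ennreal_mult_eq_top_iff less_top[symmetric])
  finally show ?thesis
    using control_measurable_occupation[OF control]
    by (intro integrableI_bounded) auto
qed

lemma control_path_measurable:
  assumes "a \<in> controls F" "\<omega> \<in> space M"
  shows "(\<lambda>u. indicator {0..} u * a u \<omega>) \<in> borel_measurable borel"
proof -
  have [measurable]: "(\<lambda>u. a (max 0 u) \<omega>) \<in> borel_measurable borel"
    using measurable_compose[OF measurable_Pair2'[OF assms(2), of borel] control_measurable[OF assms(1)]]
    by simp
  have "(\<lambda>u. indicator {0..} u * a (max 0 u) \<omega>) \<in> borel_measurable borel"
    by measurable
  also have "(\<lambda>u. indicator {0..} u * a (max 0 u) \<omega>) = (\<lambda>u. indicator {0..} u * a u \<omega>)"
    by (auto simp: fun_eq_iff split: split_indicator)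
  finally show ?thesis .
qed

lemma control_path_measurable_time:
  assumes "a \<in> controls F" "\<omega> \<in> space M"
  shows "(\<lambda>u. a u \<omega>) \<in> borel_measurable time"
proof -
  have "(\<lambda>u. indicator {0..} u * a u \<omega>) \<in> borel_measurable time"
    using control_path_measurable[OF assms] by (intro measurable_restrict_space1) simp
  also have "?this \<longleftrightarrow> ?thesis"
    by (rule measurable_cong) simp
  finally show ?thesis .
qed

text \<open>Square integrability against the discounted measure gives, path by path, local
  integrability: on \<open>[0, t]\<close> the discount factor is at least \<open>e\<^sup>-\<^sup>\<beta>\<^sup>t\<close>, and
  \<open>\<bar>x\<bar> \<le> 1 + x\<^sup>2\<close>.  Consequently the drift of the optimal state is a genuine integral and
  depends additively on perturbations of the control.\<close>

lemma AE_control_set_integrable: "AE \<omega> in M. \<forall>t\<ge>0. set_integrable lborel {0..t} (\<lambda>u. \<alpha> u \<omega>)"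
proof -
  interpret pair_sigma_finite "discounted_time \<beta>" M
    by (rule pair_sigma_finite_occupation)
  note [measurable] = control_measurable_occupation[OF control]
  have [measurable]: "(\<lambda>p. \<alpha> (snd p) (fst p)) \<in> borel_measurable (M \<Otimes>\<^sub>M discounted_time \<beta>)"
    using measurable_compose[OF measurable_pair_swap' control_measurable_occupation[OF control]]
    by (simp add: split_beta)
  have "(\<integral>\<^sup>+\<omega>. (\<integral>\<^sup>+t. ennreal ((\<alpha> t \<omega>)\<^sup>2) \<partial>discounted_time \<beta>) \<partial>M)
      = (\<integral>\<^sup>+p. ennreal ((\<alpha> (fst p) (snd p))\<^sup>2) \<partial>occupation)"
    using nn_integral_snd[of "\<lambda>p. ennreal ((\<alpha> (fst p) (snd p))\<^sup>2)"] by simp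
  also have "\<dots> < \<infinity>"
    using integrable_control_square by (simp add: integrable_iff_bounded)
  finally have "AE \<omega> in M. (\<integral>\<^sup>+t. ennreal ((\<alpha> t \<omega>)\<^sup>2) \<partial>discounted_time \<beta>) \<noteq> \<infinity>"
    by (intro nn_integral_PInf_AE) (auto simp: less_top)
  then show ?thesis
    using AE_space
  proof eventually_elim
    case (elim \<omega>)
    have meas: "(\<lambda>u. indicator {0..} u * \<alpha> u \<omega>) \<in> borel_measurable borel"
      by (rule control_path_measurable[OF control elim(2)])
    have meas_time: "(\<lambda>u. \<alpha> u \<omega>) \<in> borel_measurable time"
      by (rule control_path_measurable_time[OF control elim(2)])
    show ?case
    proof (intro allI impI)
      fix t :: real assume t: "t \<ge> 0"
      have [measurable]: "(\<lambda>u. indicator {0..t} u * \<alpha> u \<omega>) \<in> borel_measurable borel"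
      proof -
        have "(\<lambda>u. indicator {0..t} u * (indicator {0..} u * \<alpha> u \<omega>)) \<in> borel_measurable borel"
          using meas by measurable
        also have "(\<lambda>u. indicator {0..t} u * (indicator {0..} u * \<alpha> u \<omega>)) = (\<lambda>u. indicator {0..t} u * \<alpha> u \<omega>)"
          by (auto simp: fun_eq_iff split: split_indicator)
        finally show ?thesis .
      qed
      have "(\<integral>\<^sup>+u. ennreal (norm (indicator {0..t} u * \<alpha> u \<omega>)) \<partial>lborel)
         \<le> (\<integral>\<^sup>+u. indicator {0..t} u + ennreal (exp (\<beta> * t)) * (ennreal (exp (- \<beta> * u)) * ennreal ((\<alpha> u \<omega>)\<^sup>2) * indicator {0..} u) \<partial>lborel)"
      proof (intro nn_integral_mono)
        fix u :: real
        show "ennreal (norm (indicator {0..t} u * \<alpha> u \<omega>))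
          \<le> indicator {0..t} u + ennreal (exp (\<beta> * t)) * (ennreal (exp (- \<beta> * u)) * ennreal ((\<alpha> u \<omega>)\<^sup>2) * indicator {0..} u)"
        proof (cases "u \<in> {0..t}")
          case True
          then have "1 \<le> exp (\<beta> * t) * exp (- \<beta> * u)"
            using beta_pos by (simp flip: exp_add)
          then have "(\<alpha> u \<omega>)\<^sup>2 \<le> exp (\<beta> * t) * exp (- \<beta> * u) * (\<alpha> u \<omega>)\<^sup>2"
            by (intro mult_le_cancel_right1[THEN iffD2]) (auto simp: not_less[symmetric])
          moreover have "\<bar>\<alpha> u \<omega>\<bar> \<le> 1 + (\<alpha> u \<omega>)\<^sup>2"
          proof -
            have "0 \<le> (\<bar>\<alpha> u \<omega>\<bar> - 1)\<^sup>2" by simp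
            then have "2 * \<bar>\<alpha> u \<omega>\<bar> \<le> 1 + (\<alpha> u \<omega>)\<^sup>2"
              by (simp add: power2_diff)
            then show ?thesis by linarith
          qed
          ultimately have "\<bar>\<alpha> u \<omega>\<bar> \<le> 1 + exp (\<beta> * t) * (exp (- \<beta> * u) * (\<alpha> u \<omega>)\<^sup>2)"
            by (simp add: mult.assoc)
          then have "ennreal \<bar>\<alpha> u \<omega>\<bar> \<le> ennreal (1 + exp (\<beta> * t) * (exp (- \<beta> * u) * (\<alpha> u \<omega>)\<^sup>2))"
            by (rule ennreal_leI)
          then show ?thesis
            using True by (simp add: ennreal_mult ennreal_plus)
        qed (simp)
      qed
      also have "\<dots> = ennreal t + ennreal (exp (\<beta> * t)) * (\<integral>\<^sup>+u. ennreal ((\<alpha> u \<omega>)\<^sup>2) \<partial>discounted_time \<beta>)"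
      proof -
        have [measurable]: "(\<lambda>u. ennreal (exp (- \<beta> * u)) * ennreal ((\<alpha> u \<omega>)\<^sup>2) * indicator {0..} u) \<in> borel_measurable borel"
        proof -
          have "(\<lambda>u. ennreal (exp (- \<beta> * u)) * ennreal ((indicator {0..} u * \<alpha> u \<omega>)\<^sup>2)) \<in> borel_measurable borel"
            using meas by measurable
          also have "(\<lambda>u. ennreal (exp (- \<beta> * u)) * ennreal ((indicator {0..} u * \<alpha> u \<omega>)\<^sup>2))
             = (\<lambda>u. ennreal (exp (- \<beta> * u)) * ennreal ((\<alpha> u \<omega>)\<^sup>2) * indicator {0..} u)"
            by (auto simp: fun_eq_iff split: split_indicator)
          finally show ?thesis .
        qed
        have "(\<integral>\<^sup>+u. indicator {0..t} u + ennreal (exp (\<beta> * t)) * (ennreal (exp (- \<beta> * u)) * ennreal ((\<alpha> u \<omega>)\<^sup>2) * indicator {0..} u) \<partial>lborel)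
          = (\<integral>\<^sup>+u. indicator {0..t} u \<partial>lborel) + ennreal (exp (\<beta> * t)) * (\<integral>\<^sup>+u. ennreal (exp (- \<beta> * u)) * ennreal ((\<alpha> u \<omega>)\<^sup>2) * indicator {0..} u \<partial>lborel)"
          by (subst nn_integral_add) (measurable, subst nn_integral_cmult, measurable)
        also have "(\<integral>\<^sup>+u. ennreal (exp (- \<beta> * u)) * ennreal ((\<alpha> u \<omega>)\<^sup>2) * indicator {0..} u \<partial>lborel)
           = (\<integral>\<^sup>+u. ennreal ((\<alpha> u \<omega>)\<^sup>2) \<partial>discounted_time \<beta>)"
          using meas_time
          by (subst nn_integral_discounted_time) (auto simp: nn_integral_restrict_space)
        finally show ?thesis
          using t by simp
      qed
      also have "\<dots> < \<infinity>"
        using elim(1) by (simp add: ennreal_mult_less_top less_top)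
      finally show "set_integrable lborel {0..t} (\<lambda>u. \<alpha> u \<omega>)"
        unfolding set_integrable_def by (intro integrableI_bounded) auto
    qed
  qed
qed


lemma AE_occupation_snd:
  assumes "AE \<omega> in M. Q \<omega>"
  shows "AE p in occupation. Q (snd p)"
proof -
  from AE_E[OF assms] obtain N where N: "{\<omega> \<in> space M. \<not> Q \<omega>} \<subseteq> N" "N \<in> null_sets M"
    by (metis null_setsI)
  have "space (discounted_time \<beta>) \<times> N \<in> null_sets occupation"
    by (rule times_in_null_sets2[OF sets.top N(2)])
  then show ?thesis
    by (rule AE_I') (use N(1) in \<open>auto simp: space_pair_measure\<close>)
qed

text \<open>The interaction cost is less sensitive to the position of the player the closer the
  population is to incoherence.\<close>

lemma interaction_lipschitz:
  assumes "norm z \<le> S"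
  shows "\<bar>\<kappa> * Re (cnj z * cis x) - \<kappa> * Re (cnj z * cis y)\<bar> \<le> \<kappa> * (S * \<bar>x - y\<bar>)"
proof -
  have "\<kappa> * Re (cnj z * cis x) - \<kappa> * Re (cnj z * cis y) = \<kappa> * Re (cnj z * (cis x - cis y))"
    by (simp add: algebra_simps)
  moreover have "\<bar>Re (cnj z * (cis x - cis y))\<bar> \<le> norm (cnj z * (cis x - cis y))"
    by (rule abs_Re_le_cmod)
  moreover have "norm (cnj z * (cis x - cis y)) \<le> S * \<bar>x - y\<bar>"
    unfolding norm_mult complex_mod_cnj by (intro mult_mono assms norm_cis_diff_le)
      (use order_trans[OF norm_ge_zero assms] in auto)
  ultimately show ?thesis
    using kappa_pos by (simp add: abs_mult)
qed

text \<open>Replacing \<open>\<alpha>\<close> by \<open>\<alpha> + \<eta>\<close> changes the quadratic cost by \<open>\<alpha> \<eta> + \<eta>\<^sup>2 / 2\<close> and displaces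
  the path by at most the integral of \<open>w\<close>.  The displacement vanishes before time \<open>a\<close>, and from then on
  it raises the interaction cost by at most \<open>\<kappa> S\<close> times its size.  Optimality makes the sum of these
  changes nonnegative.\<close>

lemma variational_inequality:
  assumes \<eta>: "\<eta> \<in> controls F" and \<eta>w: "\<And>s \<omega>. s \<ge> 0 \<Longrightarrow> \<bar>\<eta> s \<omega>\<bar> \<le> w s"
    and w [measurable]: "w \<in> borel_measurable borel" and w0: "\<And>s. 0 \<le> w s" and wC: "\<And>s. w s \<le> C"
    and wa: "\<And>s. s < a \<Longrightarrow> w s = 0"
    and S: "\<And>t. 0 \<le> t \<Longrightarrow> a \<le> t \<Longrightarrow> norm (circular_mean \<mu> t) \<le> S"
    and D_int: "integrable occupation (\<lambda>p. LINT u:{0..fst p}|lborel. w u)"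
  shows "0 \<le> (\<integral>p. \<alpha> (fst p) (snd p) * \<eta> (fst p) (snd p) \<partial>occupation)
      + (\<integral>p. (\<eta> (fst p) (snd p))\<^sup>2 / 2 \<partial>occupation)
      + \<kappa> * S * (\<integral>p. (LINT u:{0..fst p}|lborel. w u) \<partial>occupation)"
proof -
  interpret occ: finite_measure occupation by (rule finite_measure_occupation)
  define D where "D t = (LINT u:{0..t}|lborel. w u)" for t
  define a' where "a' t \<omega> = \<alpha> t \<omega> + \<eta> t \<omega>" for t \<omega>
  have a': "a' \<in> controls F"
    using control \<eta> unfolding a'_def controls_def split_beta by (auto intro!: borel_measurable_add)
  note [measurable] = control_measurable_occupation[OF control] control_measurable_occupation[OF \<eta>]
  obtain P :: "real \<Rightarrow> 'a \<Rightarrow> real"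
    where P: "(\<lambda>(t, \<omega>). P t \<omega>) \<in> borel_measurable (borel \<Otimes>\<^sub>M M)"
      "AE \<omega> in M. \<forall>t\<ge>0. P t \<omega> = path \<alpha> t \<omega>"
    by (rule path_version_measurable[OF control])
  obtain P' :: "real \<Rightarrow> 'a \<Rightarrow> real"
    where P': "(\<lambda>(t, \<omega>). P' t \<omega>) \<in> borel_measurable (borel \<Otimes>\<^sub>M M)"
      "AE \<omega> in M. \<forall>t\<ge>0. P' t \<omega> = path a' t \<omega>"
    by (rule path_version_measurable[OF a'])
  note [measurable] = running_cost_measurable[OF P(1) control circular_mean_measurable]
    running_cost_measurable[OF P'(1) a' circular_mean_measurable]
  have \<eta>C: "\<bar>\<eta> (fst p) (snd p)\<bar> \<le> C" if "p \<in> space occupation" for p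
    using \<eta>w[of "fst p" "snd p"] wC[of "fst p"] that by (auto simp: space_pair_measure)
  then have \<eta>C2: "(\<eta> (fst p) (snd p))\<^sup>2 \<le> C\<^sup>2" if "p \<in> space occupation" for p
    using that abs_le_square_iff by (metis abs_of_nonneg order_trans abs_ge_zero)
  have w_int: "set_integrable lborel {0..t} w" for t
    by (rule bounded_set_integrable_Icc[OF w w0 wC])
  have D0: "0 \<le> D t" for t
    unfolding D_def set_lebesgue_integral_def using w0 by (intro integral_nonneg_AE) auto
  have D_a: "D t = 0" if "t < a" for t
  proof -
    have "(\<lambda>u. indicator {0..t} u *\<^sub>R w u) = (\<lambda>u. 0)"
      using that wa by (auto simp: fun_eq_iff split: split_indicator)
    then show ?thesis
      by (simp add: D_def set_lebesgue_integral_def)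
  qed
  have \<eta>_drift: "set_integrable lborel {0..t} (\<lambda>u. \<eta> u \<omega>) \<and> \<bar>drift \<eta> t \<omega>\<bar> \<le> D t"
    if "\<omega> \<in> space M" for t \<omega>
  proof -
    have [measurable]: "(\<lambda>u. indicator {0..} u * \<eta> u \<omega>) \<in> borel_measurable borel"
      by (rule control_path_measurable[OF \<eta> that])
    have "(\<lambda>u. indicator {0..t} u * (indicator {0..} u * \<eta> u \<omega>)) \<in> borel_measurable borel"
      by measurable
    also have "(\<lambda>u. indicator {0..t} u * (indicator {0..} u * \<eta> u \<omega>)) = (\<lambda>u. indicator {0..t} u *\<^sub>R \<eta> u \<omega>)"
      by (auto simp: fun_eq_iff split: split_indicator)
    finally have meas: "(\<lambda>u. indicator {0..t} u *\<^sub>R \<eta> u \<omega>) \<in> borel_measurable borel" .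
    have le: "norm (indicator {0..t} u *\<^sub>R \<eta> u \<omega>) \<le> indicator {0..t} u *\<^sub>R w u" for u
      using \<eta>w[of u \<omega>] by (auto split: split_indicator)
    have int: "set_integrable lborel {0..t} (\<lambda>u. \<eta> u \<omega>)"
      unfolding set_integrable_def
      by (rule Bochner_Integration.integrable_bound[OF w_int[of t, unfolded set_integrable_def]])
         (use meas le w0 in \<open>auto simp: abs_mult\<close>)
    have "norm (\<integral>u. indicator {0..t} u *\<^sub>R \<eta> u \<omega> \<partial>lborel) \<le> (\<integral>u. norm (indicator {0..t} u *\<^sub>R \<eta> u \<omega>) \<partial>lborel)"
      by (rule integral_norm_bound)
    also have "\<dots> \<le> (\<integral>u. indicator {0..t} u *\<^sub>R w u \<partial>lborel)"
      using le by (intro integral_mono integrable_norm int[unfolded set_integrable_def]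
          w_int[unfolded set_integrable_def])
    finally show ?thesis
      using int by (simp add: drift_def D_def set_lebesgue_integral_def)
  qed
  have "AE \<omega> in M. \<forall>t\<ge>0. \<bar>P' t \<omega> - P t \<omega>\<bar> \<le> D t"
    using P(2) P'(2) AE_control_set_integrable AE_space
  proof eventually_elim
    case (elim \<omega>)
    have "P' t \<omega> - P t \<omega> = drift \<eta> t \<omega>" if "t \<ge> 0" for t
      using elim that \<eta>_drift[OF elim(4), of t] set_integral_add(2)[of lborel "{0..t}" "\<lambda>u. \<alpha> u \<omega>" "\<lambda>u. \<eta> u \<omega>"]
      by (simp add: path_def drift_def a'_def)
    then show ?case using \<eta>_drift[OF elim(4)] by simp
  qed
  from AE_occupation_snd[OF this]
  have le: "AE p in occupation. running_cost P' a' p \<le> running_cost P \<alpha> p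
     + (\<alpha> (fst p) (snd p) * \<eta> (fst p) (snd p) + (\<eta> (fst p) (snd p))\<^sup>2 / 2 + \<kappa> * S * D (fst p))"
    using AE_space
  proof eventually_elim
    case (elim p)
    then have t: "0 \<le> fst p" by (auto simp: space_pair_measure)
    define z where "z = circular_mean \<mu> (fst p)"
    have "\<bar>\<kappa> * Re (cnj z * cis (P (fst p) (snd p))) - \<kappa> * Re (cnj z * cis (P' (fst p) (snd p)))\<bar> \<le> \<kappa> * (S * D (fst p))"
    proof (cases "a \<le> fst p")
      case True
      have zS: "norm z \<le> S" unfolding z_def by (rule S[OF t True])
      have "\<bar>P (fst p) (snd p) - P' (fst p) (snd p)\<bar> \<le> D (fst p)"
        using elim(1) t by (simp add: abs_minus_commute)
      moreover have "0 \<le> S" using zS norm_ge_zero[of z] by linarith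
      ultimately have "\<kappa> * (S * \<bar>P (fst p) (snd p) - P' (fst p) (snd p)\<bar>) \<le> \<kappa> * (S * D (fst p))"
        using kappa_pos by (intro mult_left_mono) auto
      with interaction_lipschitz[OF zS] show ?thesis by (rule order_trans)
    next
      case False
      then have "D (fst p) = 0" by (simp add: D_a)
      then have "P (fst p) (snd p) = P' (fst p) (snd p)"
        using elim(1) t by force
      then show ?thesis using \<open>D (fst p) = 0\<close> by simp
    qed
    moreover have "(a' (fst p) (snd p))\<^sup>2 / 2
        = (\<alpha> (fst p) (snd p))\<^sup>2 / 2 + \<alpha> (fst p) (snd p) * \<eta> (fst p) (snd p) + (\<eta> (fst p) (snd p))\<^sup>2 / 2"
      by (simp add: a'_def power2_sum add_divide_distrib)
    ultimately show ?case
      unfolding running_cost_def z_def mult.assoc[of \<kappa> S] by linarith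
  qed
  have C_int: "integrable occupation (\<lambda>p. (\<alpha> (fst p) (snd p))\<^sup>2 + c)" for c
    by (intro Bochner_Integration.integrable_add integrable_control_square) auto
  have f_int: "integrable occupation (running_cost P \<alpha>)"
  proof (rule Bochner_Integration.integrable_bound[OF C_int[of "2 * \<kappa>"]])
    show "AE p in occupation. norm (running_cost P \<alpha> p) \<le> norm ((\<alpha> (fst p) (snd p))\<^sup>2 + 2 * \<kappa>)"
    proof (rule AE_I2)
      fix p assume p: "p \<in> space occupation"
      have "0 \<le> (\<alpha> (fst p) (snd p))\<^sup>2" by simp
      then show "norm (running_cost P \<alpha> p) \<le> norm ((\<alpha> (fst p) (snd p))\<^sup>2 + 2 * \<kappa>)"
        using running_cost_bounds(1)[OF p, where a=\<alpha> and P=P] running_cost_bounds(2)[OF p, where a=\<alpha> and P=P] kappa_pos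
        unfolding real_norm_def by linarith
    qed
  qed measurable
  have prod_le: "\<bar>\<alpha> (fst p) (snd p) * \<eta> (fst p) (snd p)\<bar> \<le> ((\<alpha> (fst p) (snd p))\<^sup>2 + C\<^sup>2) / 2"
    if "p \<in> space occupation" for p
  proof -
    have "0 \<le> (\<bar>\<alpha> (fst p) (snd p)\<bar> - \<bar>\<eta> (fst p) (snd p)\<bar>)\<^sup>2" by simp
    then have "2 * (\<bar>\<alpha> (fst p) (snd p)\<bar> * \<bar>\<eta> (fst p) (snd p)\<bar>) \<le> (\<alpha> (fst p) (snd p))\<^sup>2 + (\<eta> (fst p) (snd p))\<^sup>2"
      by (simp add: power2_diff)
    then show ?thesis using \<eta>C2[OF that] by (simp add: abs_mult)
  qed
  have f'_int: "integrable occupation (running_cost P' a')"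
  proof (rule Bochner_Integration.integrable_bound[OF C_int[of "2 * \<kappa> + C\<^sup>2"]])
    show "AE p in occupation. norm (running_cost P' a' p) \<le> norm ((\<alpha> (fst p) (snd p))\<^sup>2 + (2 * \<kappa> + C\<^sup>2))"
    proof (rule AE_I2)
      fix p assume p: "p \<in> space occupation"
      have "(a' (fst p) (snd p))\<^sup>2 / 2 = (\<alpha> (fst p) (snd p))\<^sup>2 / 2 + \<alpha> (fst p) (snd p) * \<eta> (fst p) (snd p) + (\<eta> (fst p) (snd p))\<^sup>2 / 2"
        by (simp add: a'_def power2_sum add_divide_distrib)
      then have "(a' (fst p) (snd p))\<^sup>2 / 2 \<le> (\<alpha> (fst p) (snd p))\<^sup>2 + C\<^sup>2"
        using abs_le_D1[OF prod_le[OF p]] \<eta>C2[OF p] by argo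
      moreover have "0 \<le> (a' (fst p) (snd p))\<^sup>2" by simp
      ultimately show "norm (running_cost P' a' p) \<le> norm ((\<alpha> (fst p) (snd p))\<^sup>2 + (2 * \<kappa> + C\<^sup>2))"
        using running_cost_bounds(1)[OF p, where a=a' and P=P'] running_cost_bounds(2)[OF p, where a=a' and P=P'] kappa_pos
        unfolding real_norm_def by linarith
    qed
  qed measurable
  have int1: "integrable occupation (\<lambda>p. \<alpha> (fst p) (snd p) * \<eta> (fst p) (snd p))"
  proof (rule Bochner_Integration.integrable_bound[OF C_int[of "C\<^sup>2"]])
    show "AE p in occupation. norm (\<alpha> (fst p) (snd p) * \<eta> (fst p) (snd p)) \<le> norm ((\<alpha> (fst p) (snd p))\<^sup>2 + C\<^sup>2)"
    proof (rule AE_I2)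
      fix p assume p: "p \<in> space occupation"
      have "0 \<le> (\<alpha> (fst p) (snd p))\<^sup>2 + C\<^sup>2" by simp
      then show "norm (\<alpha> (fst p) (snd p) * \<eta> (fst p) (snd p)) \<le> norm ((\<alpha> (fst p) (snd p))\<^sup>2 + C\<^sup>2)"
        unfolding real_norm_def by (intro order_trans[OF prod_le[OF p]]) simp
    qed
  qed measurable
  have int2: "integrable occupation (\<lambda>p. (\<eta> (fst p) (snd p))\<^sup>2 / 2)"
    using \<eta>C2 by (intro occ.integrable_const_bound[of _ "C\<^sup>2 / 2"] AE_I2) auto
  have int3: "integrable occupation (\<lambda>p. \<kappa> * S * D (fst p))"
    using D_int by (simp add: D_def)
  note int12 = Bochner_Integration.integrable_add[OF int1 int2]
  note v_int = Bochner_Integration.integrable_add[OF int12 int3]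
  have nonneg: "AE p in occupation. 0 \<le> running_cost P0 a0 p" for P0 a0
  proof (rule AE_I2)
    fix p assume p: "p \<in> space occupation"
    have "0 \<le> (a0 (fst p) (snd p))\<^sup>2 / 2" by simp
    then show "0 \<le> running_cost P0 a0 p"
      using running_cost_bounds(1)[OF p, where a=a0 and P=P0] by linarith
  qed
  have "ennreal (\<integral>p. running_cost P \<alpha> p \<partial>occupation) \<le> ennreal (\<integral>p. running_cost P' a' p \<partial>occupation)"
    using optimal_running_cost[OF P P' a'] nonneg
    by (simp add: nn_integral_eq_integral f_int f'_int)
  then have "(\<integral>p. running_cost P \<alpha> p \<partial>occupation) \<le> (\<integral>p. running_cost P' a' p \<partial>occupation)"
    using nonneg by (subst (asm) ennreal_le_iff) (auto intro: integral_nonneg_AE)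
  also have "\<dots> \<le> (\<integral>p. running_cost P \<alpha> p + (\<alpha> (fst p) (snd p) * \<eta> (fst p) (snd p)
      + (\<eta> (fst p) (snd p))\<^sup>2 / 2 + \<kappa> * S * D (fst p)) \<partial>occupation)"
    by (intro integral_mono_AE f'_int Bochner_Integration.integrable_add[OF f_int v_int] le)
  also have "\<dots> = (\<integral>p. running_cost P \<alpha> p \<partial>occupation) + (\<integral>p. \<alpha> (fst p) (snd p) * \<eta> (fst p) (snd p)
      + (\<eta> (fst p) (snd p))\<^sup>2 / 2 + \<kappa> * S * D (fst p) \<partial>occupation)"
    by (rule Bochner_Integration.integral_add[OF f_int v_int])
  finally have "0 \<le> (\<integral>p. \<alpha> (fst p) (snd p) * \<eta> (fst p) (snd p)
      + (\<eta> (fst p) (snd p))\<^sup>2 / 2 + \<kappa> * S * D (fst p) \<partial>occupation)"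
    by simp
  then show ?thesis
    unfolding Bochner_Integration.integral_add[OF int12 int3] Bochner_Integration.integral_add[OF int1 int2]
    by (simp add: D_def)
qed




text \<open>The factor \<open>e\<^sup>\<beta>\<^sup>u\<close> cancels the discount, so that the time integral of \<open>\<bar>\<alpha>\<bar>\<close> over
  \<open>[a, a + h]\<close> comes out unweighted.\<close>

definition weight :: "real \<Rightarrow> real \<Rightarrow> real \<Rightarrow> real" where
  "weight a h u = indicator {a..a + h} u * exp (\<beta> * u)"

lemma weight_measurable [measurable]: "weight a h \<in> borel_measurable borel"
  unfolding weight_def by measurable

lemma weight_nonneg: "0 \<le> weight a h u"
  by (simp add: weight_def)

lemma weight_le: "weight a h u \<le> exp (\<beta> * (a + h))"
  using beta_pos by (auto simp: weight_def split: split_indicator)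

lemma weight_set_integrable: "set_integrable lborel {0..t} (weight a h)"
  by (rule bounded_set_integrable_Icc[OF weight_measurable weight_nonneg weight_le])

text \<open>By Fubini: a displacement created at time \<open>u\<close> persists and costs
  \<open>\<integral>\<^sub>u\<^sup>\<infinity> e\<^sup>-\<^sup>\<beta>\<^sup>t dt = e\<^sup>-\<^sup>\<beta>\<^sup>u / \<beta>\<close>, against which the weight \<open>e\<^sup>\<beta>\<^sup>u\<close> cancels.\<close>

lemma nn_integral_weight_drift:
  assumes "0 \<le> a" "0 \<le> h"
  shows "(\<integral>\<^sup>+t. ennreal (LINT u:{0..t}|lborel. weight a h u) \<partial>discounted_time \<beta>) = ennreal (h / \<beta>)"
proof -
  define e where "e t = ennreal (exp (- \<beta> * t))" for t
  have [measurable]: "e \<in> borel_measurable borel" unfolding e_def by measurable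
  define K where "K t u = e t * (ennreal (weight a h u) * (if 0 \<le> u \<and> u \<le> t then 1 else 0))" for t u
  have D: "ennreal (LINT u:{0..t}|lborel. weight a h u)
      = (\<integral>\<^sup>+u. ennreal (weight a h u) * (if 0 \<le> u \<and> u \<le> t then 1 else 0) \<partial>lborel)" for t
  proof -
    have "ennreal (LINT u:{0..t}|lborel. weight a h u) = (\<integral>\<^sup>+u. ennreal (indicator {0..t} u *\<^sub>R weight a h u) \<partial>lborel)"
      unfolding set_lebesgue_integral_def
      by (intro nn_integral_eq_integral[symmetric] weight_set_integrable[unfolded set_integrable_def])
         (simp add: weight_nonneg)
    also have "\<dots> = (\<integral>\<^sup>+u. ennreal (weight a h u) * (if 0 \<le> u \<and> u \<le> t then 1 else 0) \<partial>lborel)"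
      by (intro nn_integral_cong) (auto split: split_indicator)
    finally show ?thesis .
  qed
  have [measurable]: "(\<lambda>t. \<integral>\<^sup>+u. ennreal (weight a h u) * (if 0 \<le> u \<and> u \<le> t then 1 else 0) \<partial>lborel) \<in> borel_measurable borel"
    by measurable
  have "(\<integral>\<^sup>+t. ennreal (LINT u:{0..t}|lborel. weight a h u) \<partial>discounted_time \<beta>)
      = (\<integral>\<^sup>+t. e t * (\<integral>\<^sup>+u. ennreal (weight a h u) * (if 0 \<le> u \<and> u \<le> t then 1 else 0) \<partial>lborel) * indicator {0..} t \<partial>lborel)"
    unfolding D e_def
    by (subst nn_integral_discounted_time) (auto intro!: measurable_restrict_space1 simp: nn_integral_restrict_space)
  also have "\<dots> = (\<integral>\<^sup>+t. (\<integral>\<^sup>+u. K t u \<partial>lborel) \<partial>lborel)"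
  proof (intro nn_integral_cong)
    fix t :: real
    have 1: "(\<integral>\<^sup>+u. K t u \<partial>lborel) = e t * (\<integral>\<^sup>+u. ennreal (weight a h u) * (if 0 \<le> u \<and> u \<le> t then 1 else 0) \<partial>lborel)"
      unfolding K_def by (rule nn_integral_cmult) measurable
    have 2: "(\<integral>\<^sup>+u. ennreal (weight a h u) * (if 0 \<le> u \<and> u \<le> t then 1 else 0) \<partial>lborel) = 0" if "\<not> 0 \<le> t"
      using that by (intro nn_integral_zero') auto
    show "e t * (\<integral>\<^sup>+u. ennreal (weight a h u) * (if 0 \<le> u \<and> u \<le> t then 1 else 0) \<partial>lborel) * indicator {0..} t
        = (\<integral>\<^sup>+u. K t u \<partial>lborel)"
      unfolding 1 using 2 by (auto split: split_indicator)
  qed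
  also have "\<dots> = (\<integral>\<^sup>+u. (\<integral>\<^sup>+t. K t u \<partial>lborel) \<partial>lborel)"
    by (rule lborel_pair.Fubini'[symmetric]) (unfold K_def, measurable)
  also have "\<dots> = (\<integral>\<^sup>+u. ennreal (1 / \<beta>) * indicator {a..a + h} u \<partial>lborel)"
  proof (intro nn_integral_cong)
    fix u :: real
    show "(\<integral>\<^sup>+t. K t u \<partial>lborel) = ennreal (1 / \<beta>) * indicator {a..a + h} u"
    proof (cases "u \<in> {a..a + h}")
      case True
      then have "K t u = ennreal (exp (\<beta> * u)) * (e t * indicator {u..} t)" for t
        using assms(1) by (auto simp: K_def weight_def mult_ac split: split_indicator)
      then have "(\<integral>\<^sup>+t. K t u \<partial>lborel) = ennreal (exp (\<beta> * u)) * (\<integral>\<^sup>+t. e t * indicator {u..} t \<partial>lborel)"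
        by (simp add: nn_integral_cmult)
      also have "\<dots> = ennreal (exp (\<beta> * u)) * ennreal (exp (- \<beta> * u) / \<beta>)"
        unfolding e_def nn_integral_exp_atLeast[OF beta_pos] ..
      also have "\<dots> = ennreal (1 / \<beta>)"
        using beta_pos by (simp flip: ennreal_mult exp_add)
      finally show ?thesis using True by simp
    qed (simp add: K_def weight_def)
  qed
  also have "\<dots> = ennreal (1 / \<beta>) * ennreal h"
    using assms by (simp add: nn_integral_cmult_indicator)
  also have "\<dots> = ennreal (h / \<beta>)"
    using beta_pos assms by (simp flip: ennreal_mult)
  finally show ?thesis .
qed

lemma integral_weight_drift:
  assumes "0 \<le> a" "0 \<le> h"
  shows "integrable occupation (\<lambda>p. LINT u:{0..fst p}|lborel. weight a h u)"
    and "(\<integral>p. (LINT u:{0..fst p}|lborel. weight a h u) \<partial>occupation) = h / \<beta>"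
proof -
  define D where "D t = (LINT u:{0..t}|lborel. weight a h u)" for t
  have D0: "0 \<le> D t" for t
    unfolding D_def set_lebesgue_integral_def
    by (intro integral_nonneg_AE AE_I2) (simp add: weight_nonneg)
  have "D = (\<lambda>t. \<integral>u. (if 0 \<le> u \<and> u \<le> t then 1 else 0) * weight a h u \<partial>lborel)"
    unfolding D_def set_lebesgue_integral_def
    by (intro ext Bochner_Integration.integral_cong) (auto split: split_indicator)
  also have "\<dots> \<in> borel_measurable borel"
    by measurable
  finally have D_meas: "D \<in> borel_measurable borel" .
  then have Dd: "D \<in> borel_measurable (discounted_time \<beta>)"
    by (simp add: measurable_restrict_space1 cong: measurable_cong_sets[OF sets_discounted_time])
  then have [measurable]: "(\<lambda>p. D (fst p)) \<in> borel_measurable occupation"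
    by measurable
  have "(\<integral>\<^sup>+p. ennreal (D (fst p)) \<partial>occupation) = (\<integral>\<^sup>+t. (\<integral>\<^sup>+\<omega>. ennreal (D t) \<partial>M) \<partial>discounted_time \<beta>)"
    using nn_integral_fst[of "\<lambda>p. ennreal (D (fst p))" "discounted_time \<beta>"] by simp
  also have "\<dots> = (\<integral>\<^sup>+t. ennreal (D t) \<partial>discounted_time \<beta>)"
    by (simp add: emeasure_space_1)
  also have "\<dots> = ennreal (h / \<beta>)"
    using nn_integral_weight_drift[OF assms] by (simp add: D_def)
  finally have "integrable occupation (\<lambda>p. D (fst p)) \<and> (\<integral>p. D (fst p) \<partial>occupation) = h / \<beta>"
    using D0 assms beta_pos by (subst (asm) nn_integral_eq_integrable) auto
  then show "integrable occupation (\<lambda>p. LINT u:{0..fst p}|lborel. weight a h u)"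
    and "(\<integral>p. (LINT u:{0..fst p}|lborel. weight a h u) \<partial>occupation) = h / \<beta>"
    by (auto simp: D_def)
qed


text \<open>The variational inequality for \<open>\<eta> = - \<epsilon> sgn(\<alpha>) w\<close> with the weight \<open>w\<close> above: its
  linear term is \<open>- \<epsilon> \<bar>\<alpha>\<bar> w\<close>, and dividing by \<open>\<epsilon>\<close> and letting \<open>\<epsilon> \<rightarrow> 0\<close> removes the quadratic
  term.\<close>

lemma control_budget:
  assumes "0 \<le> a" "0 \<le> h" and S: "\<And>t. a \<le> t \<Longrightarrow> norm (circular_mean \<mu> t) \<le> S"
  shows "(\<integral>\<^sup>+\<omega>. (\<integral>\<^sup>+u. ennreal \<bar>\<alpha> u \<omega>\<bar> * indicator {a..a + h} u \<partial>lborel) \<partial>M) \<le> ennreal (\<kappa> * S * h / \<beta>)"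
proof -
  interpret occ: finite_measure occupation by (rule finite_measure_occupation)
  interpret pair_sigma_finite "discounted_time \<beta>" M
    by (rule pair_sigma_finite_occupation)
  define C where "C = exp (\<beta> * (a + h))"
  define D where "D t = (LINT u:{0..t}|lborel. weight a h u)" for t
  note [measurable] = control_measurable_occupation[OF control]
  have W [measurable]: "(\<lambda>p. weight a h (fst p)) \<in> borel_measurable occupation"
    by (rule measurable_occupation) measurable
  have A_int: "integrable occupation (\<lambda>p. \<bar>\<alpha> (fst p) (snd p)\<bar> * weight a h (fst p))"
  proof (rule Bochner_Integration.integrable_bound)
    show "integrable occupation (\<lambda>p. ((\<alpha> (fst p) (snd p))\<^sup>2 + 1) * C)"
      by (intro integrable_mult_left Bochner_Integration.integrable_add integrable_control_square) auto
    have "\<bar>\<alpha> t \<omega>\<bar> * weight a h t \<le> ((\<alpha> t \<omega>)\<^sup>2 + 1) * C" for t \<omega>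
    proof (intro mult_mono)
      have "0 \<le> (\<bar>\<alpha> t \<omega>\<bar> - 1)\<^sup>2" by simp
      then have "2 * \<bar>\<alpha> t \<omega>\<bar> \<le> 1 + (\<alpha> t \<omega>)\<^sup>2" by (simp add: power2_diff)
      then show "\<bar>\<alpha> t \<omega>\<bar> \<le> (\<alpha> t \<omega>)\<^sup>2 + 1" by linarith
    qed (auto simp: weight_le weight_nonneg C_def)
    moreover have "0 \<le> ((\<alpha> t \<omega>)\<^sup>2 + 1) * C" for t \<omega>
      by (simp add: C_def)
    ultimately show "AE p in occupation. norm (\<bar>\<alpha> (fst p) (snd p)\<bar> * weight a h (fst p)) \<le> norm (((\<alpha> (fst p) (snd p))\<^sup>2 + 1) * C)"
      by (intro AE_I2) (simp add: abs_of_nonneg weight_nonneg)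
  qed measurable
  define A where "A = (\<integral>p. \<bar>\<alpha> (fst p) (snd p)\<bar> * weight a h (fst p) \<partial>occupation)"
  define K where "K = C\<^sup>2 / 2 * measure occupation (space occupation)"
  have "A \<le> \<kappa> * S * (h / \<beta>) + \<epsilon> * K" if \<epsilon>: "0 < \<epsilon>" for \<epsilon>
  proof -
    define \<eta> where "\<eta> u \<omega> = - \<epsilon> * sgn (\<alpha> u \<omega>) * weight a h u" for u \<omega>
    have \<eta>_control: "\<eta> \<in> controls F"
    proof -
      have "(\<lambda>p. - \<epsilon> * sgn (\<alpha> (fst p) (snd p)) * weight a h (fst p)) \<in> borel_measurable (restrict_space borel {0..t} \<Otimes>\<^sub>M F t)"
        if "t \<ge> 0" for t
      proof -
        have [measurable]: "(\<lambda>p. \<alpha> (fst p) (snd p)) \<in> borel_measurable (restrict_space borel {0..t} \<Otimes>\<^sub>M F t)"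
          using control that unfolding controls_def split_beta by blast
        have [measurable]: "weight a h \<in> borel_measurable (restrict_space borel {0..t})"
          by (intro measurable_restrict_space1) simp
        show ?thesis by measurable
      qed
      then show ?thesis unfolding controls_def \<eta>_def split_beta by blast
    qed
    have \<eta>_le: "\<bar>\<eta> u \<omega>\<bar> \<le> \<epsilon> * weight a h u" for u \<omega>
      using \<epsilon> by (auto simp: \<eta>_def abs_mult sgn_if weight_nonneg)
    have scaled: "(LINT u:{0..t}|lborel. \<epsilon> * weight a h u) = \<epsilon> * D t" for t
      by (simp add: D_def)
    have D_int: "integrable occupation (\<lambda>p. D (fst p))" "(\<integral>p. D (fst p) \<partial>occupation) = h / \<beta>"
      using integral_weight_drift[OF assms(1,2)] by (auto simp: D_def)
    have "0 \<le> (\<integral>p. \<alpha> (fst p) (snd p) * \<eta> (fst p) (snd p) \<partial>occupation)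
      + (\<integral>p. (\<eta> (fst p) (snd p))\<^sup>2 / 2 \<partial>occupation)
      + \<kappa> * S * (\<integral>p. (LINT u:{0..fst p}|lborel. \<epsilon> * weight a h u) \<partial>occupation)"
    proof (rule variational_inequality[where C="\<epsilon> * C" and a=a])
      show "\<epsilon> * weight a h u \<le> \<epsilon> * C" for u
        using \<epsilon> weight_le[of a h u] by (simp add: C_def)
      show "\<epsilon> * weight a h u = 0" if "u < a" for u
        using that by (simp add: weight_def)
      show "integrable occupation (\<lambda>p. LINT u:{0..fst p}|lborel. \<epsilon> * weight a h u)"
        unfolding scaled using D_int by simp
      show "0 \<le> \<epsilon> * weight a h u" for u
        using \<epsilon> by (simp add: weight_nonneg)
    qed (rule \<eta>_control, rule \<eta>_le, measurable, rule S)
    also have "(\<integral>p. \<alpha> (fst p) (snd p) * \<eta> (fst p) (snd p) \<partial>occupation) = - \<epsilon> * A"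
    proof -
      have "\<alpha> t \<omega> * \<eta> t \<omega> = - \<epsilon> * (\<bar>\<alpha> t \<omega>\<bar> * weight a h t)" for t \<omega>
        by (simp add: \<eta>_def abs_sgn)
      then show ?thesis by (simp add: A_def)
    qed
    also have "(\<integral>p. (LINT u:{0..fst p}|lborel. \<epsilon> * weight a h u) \<partial>occupation) = \<epsilon> * (h / \<beta>)"
      unfolding scaled using D_int by simp
    also have "(\<integral>p. (\<eta> (fst p) (snd p))\<^sup>2 / 2 \<partial>occupation) \<le> (\<integral>p. (\<epsilon> * C)\<^sup>2 / 2 \<partial>occupation)"
    proof (rule integral_mono)
      have "\<bar>\<eta> t \<omega>\<bar> \<le> \<bar>\<epsilon> * C\<bar>" for t \<omega>
        using order_trans[OF \<eta>_le[of t \<omega>] mult_left_mono[OF weight_le[of a h t], of \<epsilon>]] \<epsilon>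
        unfolding C_def by linarith
      then have sq: "(\<eta> t \<omega>)\<^sup>2 \<le> (\<epsilon> * C)\<^sup>2" for t \<omega>
        by (rule abs_le_square_iff[THEN iffD1])
      then show "(\<eta> (fst p) (snd p))\<^sup>2 / 2 \<le> (\<epsilon> * C)\<^sup>2 / 2" for p
        by simp
      show "integrable occupation (\<lambda>p. (\<eta> (fst p) (snd p))\<^sup>2 / 2)"
        using sq control_measurable_occupation[OF \<eta>_control]
        by (intro occ.integrable_const_bound[of _ "(\<epsilon> * C)\<^sup>2 / 2"] AE_I2) auto
    qed simp
    also have "(\<integral>p. (\<epsilon> * C)\<^sup>2 / 2 \<partial>occupation) = \<epsilon>\<^sup>2 * K"
      by (simp add: K_def power_mult_distrib)
    finally have "\<epsilon> * A \<le> \<epsilon> * (\<kappa> * S * (h / \<beta>) + \<epsilon> * K)"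
      by (simp add: algebra_simps power2_eq_square)
    then show ?thesis using \<epsilon> by simp
  qed
  note A_eps = this
  have A_le: "A \<le> \<kappa> * S * (h / \<beta>)"
  proof (rule field_le_epsilon)
    fix e :: real assume "0 < e"
    have "0 \<le> K" by (simp add: K_def)
    then have "e / (K + 1) * K \<le> e"
      using \<open>0 < e\<close> by (simp add: field_simps)
    with A_eps[of "e / (K + 1)"] show "A \<le> \<kappa> * S * (h / \<beta>) + e"
      using \<open>0 \<le> K\<close> \<open>0 < e\<close> by simp
  qed
  have "(\<integral>\<^sup>+\<omega>. (\<integral>\<^sup>+u. ennreal \<bar>\<alpha> u \<omega>\<bar> * indicator {a..a + h} u \<partial>lborel) \<partial>M)
     = (\<integral>\<^sup>+\<omega>. (\<integral>\<^sup>+u. ennreal (\<bar>\<alpha> u \<omega>\<bar> * weight a h u) \<partial>discounted_time \<beta>) \<partial>M)"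
  proof (rule nn_integral_cong)
    fix \<omega> assume \<omega>: "\<omega> \<in> space M"
    have [measurable]: "(\<lambda>u. \<alpha> u \<omega>) \<in> borel_measurable time"
      by (rule control_path_measurable_time[OF control \<omega>])
    have [measurable]: "weight a h \<in> borel_measurable time"
      by (intro measurable_restrict_space1) simp
    have "(\<integral>\<^sup>+u. ennreal (\<bar>\<alpha> u \<omega>\<bar> * weight a h u) \<partial>discounted_time \<beta>)
       = (\<integral>\<^sup>+u. ennreal (exp (- \<beta> * u)) * ennreal (\<bar>\<alpha> u \<omega>\<bar> * weight a h u) * indicator {0..} u \<partial>lborel)"
      by (subst nn_integral_discounted_time) (measurable, simp add: nn_integral_restrict_space)
    also have "\<dots> = (\<integral>\<^sup>+u. ennreal \<bar>\<alpha> u \<omega>\<bar> * indicator {a..a + h} u \<partial>lborel)"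
    proof (rule nn_integral_cong)
      fix u :: real
      have "exp (- \<beta> * u) * (\<bar>\<alpha> u \<omega>\<bar> * exp (\<beta> * u)) = \<bar>\<alpha> u \<omega>\<bar>"
        by (simp add: exp_minus field_simps)
      then show "ennreal (exp (- \<beta> * u)) * ennreal (\<bar>\<alpha> u \<omega>\<bar> * weight a h u) * indicator {0..} u
          = ennreal \<bar>\<alpha> u \<omega>\<bar> * indicator {a..a + h} u"
        using assms(1) by (auto simp: weight_def simp flip: ennreal_mult split: split_indicator)
    qed
    finally show "(\<integral>\<^sup>+u. ennreal \<bar>\<alpha> u \<omega>\<bar> * indicator {a..a + h} u \<partial>lborel)
        = (\<integral>\<^sup>+u. ennreal (\<bar>\<alpha> u \<omega>\<bar> * weight a h u) \<partial>discounted_time \<beta>)" ..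
  qed
  also have "\<dots> = (\<integral>\<^sup>+p. ennreal (\<bar>\<alpha> (fst p) (snd p)\<bar> * weight a h (fst p)) \<partial>occupation)"
    using nn_integral_snd[of "\<lambda>p. ennreal (\<bar>\<alpha> (fst p) (snd p)\<bar> * weight a h (fst p))"] by simp
  also have "\<dots> = ennreal A"
    unfolding A_def by (intro nn_integral_eq_integral A_int) (simp add: weight_nonneg)
  also have "\<dots> \<le> ennreal (\<kappa> * S * h / \<beta>)"
    using A_le by (intro ennreal_leI) simp
  finally show ?thesis .
qed

end

section \<open>Decay of the Fourier coefficients\<close>

context brownian_motion
begin

lemma brownian_increment_char:
  assumes "0 \<le> s" "s < t"
  shows "(\<integral>\<omega>. cis (c * (B t \<omega> - B s \<omega>)) \<partial>M) = of_real (exp (- c\<^sup>2 * (t - s) / 2))"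
proof -
  have pos: "0 < sqrt (t - s)" using assms by simp
  define N where "N \<omega> = (B t \<omega> - B s \<omega>) / sqrt (t - s)" for \<omega>
  have N: "distributed M lborel N std_normal_density"
    using normal_increments_B[OF assms] normal_standard_normal_convert[OF pos, of "\<lambda>\<omega>. B t \<omega> - B s \<omega>" 0]
    by (simp add: N_def[abs_def])
  have [measurable]: "N \<in> borel_measurable M" using distributed_measurable[OF N] by simp
  define r where "r = c * sqrt (t - s)"
  have "(\<integral>\<omega>. cis (c * (B t \<omega> - B s \<omega>)) \<partial>M) = (\<integral>\<omega>. cis (r * N \<omega>) \<partial>M)"
    using pos by (simp add: N_def r_def)
  also have "\<dots> = (\<integral>x. cis (r * x) \<partial>distr M lborel N)"
    by (subst integral_distr) auto
  also have "\<dots> = char std_normal_distribution r"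
    by (simp add: char_def cis_conv_exp distributed_distr_eq_density[OF N])
  also have "\<dots> = of_real (exp (- c\<^sup>2 * (t - s) / 2))"
    using assms by (simp add: char_std_normal_distribution r_def power_mult_distrib)
  finally show ?thesis .
qed

lemma indep_increment:
  assumes "0 \<le> s" "s < t" "X \<in> borel_measurable (F s)"
  shows "indep_var borel X borel (\<lambda>\<omega>. B t \<omega> - B s \<omega>)"
proof -
  have [measurable]: "B t \<in> borel_measurable M" "B s \<in> borel_measurable M" "X \<in> borel_measurable M"
    using assms measurable_F[OF _ adapted_B] measurable_F[OF assms(1,3)] by auto
  let ?Y = "\<lambda>\<omega>. B t \<omega> - B s \<omega>"
  have "sigma_sets (space M) {?Y -` A \<inter> space M | A. A \<in> sets borel} = {?Y -` A \<inter> space M | A. A \<in> sets borel}"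
    using sets_vimage_algebra[of "space M" ?Y borel] sets_vimage_algebra2[of ?Y "space M" borel] by auto
  moreover have "sigma_sets (space M) {X -` A \<inter> space M | A. A \<in> sets borel} \<subseteq> sets (F s)"
    using measurable_sets[OF assms(3)] sets.sigma_sets_subset[of "{X -` A \<inter> space M | A. A \<in> sets borel}" "F s"]
    by (auto simp: space_F)
  ultimately have "indep_set (sigma_sets (space M) {X -` A \<inter> space M | A. A \<in> sets borel})
      (sigma_sets (space M) {?Y -` A \<inter> space M | A. A \<in> sets borel})"
    using indep_increments_B[OF assms(1,2)] unfolding indep_set_def
    by (elim indep_sets_mono_sets) (auto split: bool.split)
  then show ?thesis
    by (simp add: indep_var_eq)
qed


end

context kuramoto_equilibrium
begin

lemma drift_increment_le:
  assumes "0 \<le> t" "0 \<le> h" "\<forall>t\<ge>0. set_integrable lborel {0..t} (\<lambda>u. \<alpha> u \<omega>)"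
  shows "ennreal \<bar>drift \<alpha> (t + h) \<omega> - drift \<alpha> t \<omega>\<bar> \<le> (\<integral>\<^sup>+u. ennreal \<bar>\<alpha> u \<omega>\<bar> * indicator {t..t + h} u \<partial>lborel)"
proof -
  have int: "integrable lborel (\<lambda>u. indicator {0..s} u *\<^sub>R \<alpha> u \<omega>)" if "s \<ge> 0" for s
    using assms(3) that by (simp add: set_integrable_def)
  define g where "g u = indicator {0..t + h} u *\<^sub>R \<alpha> u \<omega> - indicator {0..t} u *\<^sub>R \<alpha> u \<omega>" for u
  have "0 \<le> t + h" using assms by simp
  note ints = int[OF this] int[OF assms(1)]
  have g: "integrable lborel g"
    unfolding g_def by (rule Bochner_Integration.integrable_diff[OF ints])
  have "drift \<alpha> (t + h) \<omega> - drift \<alpha> t \<omega> = (\<integral>u. g u \<partial>lborel)"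
    unfolding drift_def set_lebesgue_integral_def g_def
    by (rule Bochner_Integration.integral_diff[OF ints, symmetric])
  then have "ennreal \<bar>drift \<alpha> (t + h) \<omega> - drift \<alpha> t \<omega>\<bar> \<le> (\<integral>\<^sup>+u. ennreal (norm (g u)) \<partial>lborel)"
    using integral_norm_bound_ennreal[OF g] by simp
  also have "\<dots> \<le> (\<integral>\<^sup>+u. ennreal \<bar>\<alpha> u \<omega>\<bar> * indicator {t..t + h} u \<partial>lborel)"
  proof (rule nn_integral_mono)
    fix u
    show "ennreal (norm (g u)) \<le> ennreal \<bar>\<alpha> u \<omega>\<bar> * indicator {t..t + h} u"
      using assms(1,2) by (cases "u \<le> t"; cases "u \<le> t + h"; cases "0 \<le> u") (auto simp: g_def)
  qed
  finally show ?thesis .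
qed

text \<open>Comparison of the state at time \<open>t + h\<close> with the state \<open>Z\<close> that would result if the
  control were switched off at time \<open>t\<close>.  For \<open>Z\<close> the Gaussian increment is independent of the past,
  and the characteristic function factorises exactly.\<close>

lemma fourier_step:
  assumes "0 \<le> t" "0 < h" "0 \<le> R"
    and R: "(\<integral>\<^sup>+\<omega>. (\<integral>\<^sup>+u. ennreal \<bar>\<alpha> u \<omega>\<bar> * indicator {t..t + h} u \<partial>lborel) \<partial>M) \<le> ennreal R"
  shows "norm (\<integral>\<omega>. cis (k * path \<alpha> (t + h) \<omega>) \<partial>M)
    \<le> exp (- k\<^sup>2 * \<sigma>\<^sup>2 * h / 2) * norm (\<integral>\<omega>. cis (k * path \<alpha> t \<omega>) \<partial>M) + \<bar>k\<bar> * R"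
proof -
  have t': "0 \<le> t + h" using assms by simp
  have [measurable]: "path \<alpha> t \<in> borel_measurable M" "path \<alpha> (t + h) \<in> borel_measurable M"
    "B t \<in> borel_measurable M" "B (t + h) \<in> borel_measurable M"
    using measurable_F[OF assms(1) path_measurable_F[OF control assms(1)]]
      measurable_F[OF t' path_measurable_F[OF control t']]
      measurable_F[OF assms(1) adapted_B[OF assms(1)]] measurable_F[OF t' adapted_B[OF t']] by auto
  define \<Delta> where "\<Delta> \<omega> = B (t + h) \<omega> - B t \<omega>" for \<omega>
  have [measurable]: "\<Delta> \<in> borel_measurable M" unfolding \<Delta>_def by measurable
  define Z where "Z \<omega> = path \<alpha> t \<omega> + \<sigma> * \<Delta> \<omega>" for \<omega>
  have [measurable]: "Z \<in> borel_measurable M" unfolding Z_def by measurable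
  have int: "integrable M (\<lambda>\<omega>. cis (f \<omega>))" if "f \<in> borel_measurable M" for f
    using that by (intro integrable_const_bound[of _ 1]) auto
  have "(\<integral>\<omega>. cis (k * Z \<omega>) \<partial>M) = (\<integral>\<omega>. cis (k * path \<alpha> t \<omega>) * cis (k * \<sigma> * \<Delta> \<omega>) \<partial>M)"
    by (simp add: Z_def cis_mult algebra_simps)
  also have "\<dots> = (\<integral>\<omega>. cis (k * path \<alpha> t \<omega>) \<partial>M) * (\<integral>\<omega>. cis (k * \<sigma> * \<Delta> \<omega>) \<partial>M)"
  proof (rule indep_var_lebesgue_integral)
    have "indep_var borel (path \<alpha> t) borel \<Delta>"
      unfolding \<Delta>_def using assms by (intro indep_increment path_measurable_F control) auto
    from indep_var_compose[OF this, of "\<lambda>x. cis (k * x)" borel "\<lambda>x. cis (k * \<sigma> * x)" borel]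
    show "indep_var borel (\<lambda>\<omega>. cis (k * path \<alpha> t \<omega>)) borel (\<lambda>\<omega>. cis (k * \<sigma> * \<Delta> \<omega>))"
      by (simp add: comp_def)
  qed (rule int, measurable)+
  also have "(\<integral>\<omega>. cis (k * \<sigma> * \<Delta> \<omega>) \<partial>M) = of_real (exp (- k\<^sup>2 * \<sigma>\<^sup>2 * h / 2))"
    using brownian_increment_char[of t "t + h" "k * \<sigma>"] assms by (simp add: \<Delta>_def power_mult_distrib)
  finally have Z: "norm (\<integral>\<omega>. cis (k * Z \<omega>) \<partial>M) = exp (- k\<^sup>2 * \<sigma>\<^sup>2 * h / 2) * norm (\<integral>\<omega>. cis (k * path \<alpha> t \<omega>) \<partial>M)"
    by (simp add: norm_mult mult.commute)
  have int_path: "integrable M (\<lambda>\<omega>. cis (k * path \<alpha> (t + h) \<omega>))" and int_Z: "integrable M (\<lambda>\<omega>. cis (k * Z \<omega>))"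
    by (rule int, measurable)+
  have "ennreal (norm (\<integral>\<omega>. cis (k * path \<alpha> (t + h) \<omega>) - cis (k * Z \<omega>) \<partial>M))
      \<le> (\<integral>\<^sup>+\<omega>. ennreal (norm (cis (k * path \<alpha> (t + h) \<omega>) - cis (k * Z \<omega>))) \<partial>M)"
    by (rule integral_norm_bound_ennreal[OF Bochner_Integration.integrable_diff[OF int_path int_Z]])
  also have "\<dots> \<le> (\<integral>\<^sup>+\<omega>. ennreal \<bar>k\<bar> * (\<integral>\<^sup>+u. ennreal \<bar>\<alpha> u \<omega>\<bar> * indicator {t..t + h} u \<partial>lborel) \<partial>M)"
  proof (rule nn_integral_mono_AE)
    show "AE \<omega> in M. ennreal (norm (cis (k * path \<alpha> (t + h) \<omega>) - cis (k * Z \<omega>)))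
        \<le> ennreal \<bar>k\<bar> * (\<integral>\<^sup>+u. ennreal \<bar>\<alpha> u \<omega>\<bar> * indicator {t..t + h} u \<partial>lborel)"
      using AE_control_set_integrable
    proof eventually_elim
      case (elim \<omega>)
      have "norm (cis (k * path \<alpha> (t + h) \<omega>) - cis (k * Z \<omega>)) \<le> \<bar>k * path \<alpha> (t + h) \<omega> - k * Z \<omega>\<bar>"
        by (rule norm_cis_diff_le)
      also have "k * path \<alpha> (t + h) \<omega> - k * Z \<omega> = k * (drift \<alpha> (t + h) \<omega> - drift \<alpha> t \<omega>)"
        by (simp add: Z_def \<Delta>_def path_def algebra_simps)
      finally have "ennreal (norm (cis (k * path \<alpha> (t + h) \<omega>) - cis (k * Z \<omega>)))
          \<le> ennreal \<bar>k\<bar> * ennreal \<bar>drift \<alpha> (t + h) \<omega> - drift \<alpha> t \<omega>\<bar>"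
        unfolding abs_mult ennreal_mult[OF abs_ge_zero abs_ge_zero, symmetric] by (rule ennreal_leI)
      also have "\<dots> \<le> ennreal \<bar>k\<bar> * (\<integral>\<^sup>+u. ennreal \<bar>\<alpha> u \<omega>\<bar> * indicator {t..t + h} u \<partial>lborel)"
        by (rule mult_left_mono[OF drift_increment_le]) (use assms elim in simp_all)
      finally show ?case .
    qed
  qed
  also have "\<dots> = ennreal \<bar>k\<bar> * (\<integral>\<^sup>+\<omega>. (\<integral>\<^sup>+u. ennreal \<bar>\<alpha> u \<omega>\<bar> * indicator {t..t + h} u \<partial>lborel) \<partial>M)"
  proof (rule nn_integral_cmult)
    have [measurable]: "(\<lambda>p. \<alpha> (max 0 (snd p)) (fst p)) \<in> borel_measurable (M \<Otimes>\<^sub>M (lborel :: real measure))"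
      using measurable_compose[OF _ control_measurable[OF control],
          of "\<lambda>p. (snd p, fst p)" "M \<Otimes>\<^sub>M (lborel :: real measure)"] by simp
    have "(\<lambda>\<omega>. \<integral>\<^sup>+u. ennreal \<bar>\<alpha> (max 0 u) \<omega>\<bar> * indicator {t..t + h} u \<partial>lborel) \<in> borel_measurable M"
      by measurable
    also have "(\<lambda>\<omega>. \<integral>\<^sup>+u. ennreal \<bar>\<alpha> (max 0 u) \<omega>\<bar> * indicator {t..t + h} u \<partial>lborel)
        = (\<lambda>\<omega>. \<integral>\<^sup>+u. ennreal \<bar>\<alpha> u \<omega>\<bar> * indicator {t..t + h} u \<partial>lborel)"
      using assms(1) by (intro ext nn_integral_cong) (auto split: split_indicator)
    finally show "(\<lambda>\<omega>. \<integral>\<^sup>+u. ennreal \<bar>\<alpha> u \<omega>\<bar> * indicator {t..t + h} u \<partial>lborel) \<in> borel_measurable M" .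
  qed
  also have "\<dots> \<le> ennreal \<bar>k\<bar> * ennreal R"
    by (rule mult_left_mono[OF R]) simp
  also have "\<dots> = ennreal (\<bar>k\<bar> * R)"
    using assms by (simp add: ennreal_mult)
  finally have "norm (\<integral>\<omega>. cis (k * path \<alpha> (t + h) \<omega>) - cis (k * Z \<omega>) \<partial>M) \<le> \<bar>k\<bar> * R"
    using assms by (subst (asm) ennreal_le_iff) auto
  then have "norm ((\<integral>\<omega>. cis (k * path \<alpha> (t + h) \<omega>) \<partial>M) - (\<integral>\<omega>. cis (k * Z \<omega>) \<partial>M)) \<le> \<bar>k\<bar> * R"
    unfolding Bochner_Integration.integral_diff[OF int_path int_Z] .
  then show ?thesis
    using norm_triangle_sub[of "\<integral>\<omega>. cis (k * path \<alpha> (t + h) \<omega>) \<partial>M" "\<integral>\<omega>. cis (k * Z \<omega>) \<partial>M"] Z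
    by linarith
qed

text \<open>The induction runs over all \<open>k\<close> simultaneously: the bound for \<open>k = 1\<close> is the bound \<open>S\<close>
  on the circular mean that controls the effort in the step for every \<open>k\<close>.  The two parts of the
  step, \<open>exp (- k\<^sup>2) \<le> exp (- 1)\<close> from the noise and \<open>\<kappa> h / \<beta>\<close> from the control, add up to \<open>q\<close>.\<close>

lemma fourier_decay:
  fixes k :: int and n :: nat
  defines "h \<equiv> 2 / \<sigma>\<^sup>2"
  defines "q \<equiv> exp (- 1) + \<kappa> * h / \<beta>"
  assumes "k \<noteq> 0" "real n * h \<le> t"
  shows "norm (\<integral>\<omega>. cis (of_int k * path \<alpha> t \<omega>) \<partial>M) \<le> \<bar>of_int k\<bar> * q ^ n"
  using assms(3,4)
proof (induction n arbitrary: k t)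
  case 0
  have "norm (\<integral>\<omega>. cis (of_int k * path \<alpha> t \<omega>) \<partial>M) \<le> 1"
    by (rule norm_expectation_cis_le)
  also have "1 \<le> \<bar>real_of_int k\<bar>"
    using 0 by linarith
  finally show ?case by simp
next
  case (Suc n)
  have h: "h > 0" using sigma_pos by (simp add: h_def)
  have q: "q \<ge> 0" using h kappa_pos beta_pos by (simp add: q_def)
  define s where "s = t - h"
  have s: "real n * h \<le> s" using Suc.prems by (simp add: s_def algebra_simps)
  have s0: "0 \<le> s" using s h by (intro order_trans[OF _ s]) auto
  have "norm (circular_mean \<mu> u) \<le> q ^ n" if "s \<le> u" for u
    using Suc.IH[of 1 u] that s s0 by (simp add: circular_mean_eq)
  then have "(\<integral>\<^sup>+\<omega>. (\<integral>\<^sup>+u. ennreal \<bar>\<alpha> u \<omega>\<bar> * indicator {s..s + h} u \<partial>lborel) \<partial>M) \<le> ennreal (\<kappa> * q ^ n * h / \<beta>)"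
    using s0 h by (intro control_budget) auto
  then have "norm (\<integral>\<omega>. cis (of_int k * path \<alpha> (s + h) \<omega>) \<partial>M)
      \<le> exp (- (real_of_int k)\<^sup>2 * \<sigma>\<^sup>2 * h / 2) * norm (\<integral>\<omega>. cis (of_int k * path \<alpha> s \<omega>) \<partial>M)
        + \<bar>of_int k\<bar> * (\<kappa> * q ^ n * h / \<beta>)"
    using s0 h q kappa_pos beta_pos by (intro fourier_step) auto
  also have "(real_of_int k)\<^sup>2 * \<sigma>\<^sup>2 * h / 2 = (real_of_int k)\<^sup>2"
    using sigma_pos by (simp add: h_def)
  then have "exp (- (real_of_int k)\<^sup>2 * \<sigma>\<^sup>2 * h / 2) = exp (- (real_of_int k)\<^sup>2)"
    by simp
  also have "exp (- (real_of_int k)\<^sup>2) * norm (\<integral>\<omega>. cis (of_int k * path \<alpha> s \<omega>) \<partial>M)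
      \<le> exp (- 1) * (\<bar>of_int k\<bar> * q ^ n)"
  proof (intro mult_mono Suc.IH Suc.prems s)
    have "1 \<le> \<bar>real_of_int k\<bar>" using Suc.prems by linarith
    then have "1 \<le> (real_of_int k)\<^sup>2" by (metis one_le_power power2_abs)
    then show "exp (- (real_of_int k)\<^sup>2) \<le> exp (- 1)" by simp
  qed auto
  also have "exp (- 1) * (\<bar>of_int k\<bar> * q ^ n) + \<bar>of_int k\<bar> * (\<kappa> * q ^ n * h / \<beta>) = \<bar>of_int k\<bar> * q ^ Suc n"
    by (simp add: q_def algebra_simps)
  finally show ?case by (simp add: s_def)
qed

lemma flow_converges:
  assumes "\<kappa> < \<beta> * \<sigma>\<^sup>2 / 4"
  shows "converges_in_law \<mu> uniform_torus"
proof (rule converges_in_law_uniform_torusI[OF flow_probs])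
  fix k :: int assume k: "k \<noteq> 0"
  define h where "h = 2 / \<sigma>\<^sup>2"
  define q where "q = exp (- 1) + \<kappa> * h / \<beta>"
  have h: "h > 0" using sigma_pos by (simp add: h_def)
  have "exp (- 1) \<le> (1 / 2 :: real)"
    using exp_ge_add_one_self[of 1] by (simp add: exp_minus field_simps)
  moreover have "\<kappa> * h / \<beta> < 1 / 2"
    using assms sigma_pos beta_pos by (simp add: h_def field_simps)
  ultimately have "q < 1"
    unfolding q_def by linarith
  moreover have "0 \<le> q"
    using h kappa_pos beta_pos by (simp add: q_def)
  ultimately have q: "0 \<le> q" "q < 1" by auto
  show "((\<lambda>t. \<integral>x. torus_char k x \<partial>\<mu> t) \<longlongrightarrow> 0) at_top"
  proof (rule tendstoI)
    fix e :: real assume e: "0 < e"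
    have "(\<lambda>n. \<bar>of_int k\<bar> * q ^ n) \<longlonglongrightarrow> \<bar>of_int k\<bar> * 0"
      using q by (intro tendsto_mult_left LIMSEQ_power_zero) auto
    then have "\<forall>\<^sub>F n in sequentially. \<bar>of_int k\<bar> * q ^ n < e"
      using e by (auto dest: order_tendstoD(2))
    then obtain n where n: "\<bar>of_int k\<bar> * q ^ n < e"
      by (auto simp: eventually_sequentially)
    show "\<forall>\<^sub>F t in at_top. dist (\<integral>x. torus_char k x \<partial>\<mu> t) 0 < e"
      using eventually_ge_at_top[of "real n * h"] eventually_ge_at_top[of 0]
    proof eventually_elim
      case (elim t)
      have "norm (\<integral>x. torus_char k x \<partial>\<mu> t) \<le> \<bar>of_int k\<bar> * q ^ n"
        using fourier_decay[OF k, of n t] elim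
        by (simp add: integral_torus_char_flow h_def q_def)
      then show ?case using n by simp
    qed
  qed
qed

end

theorem lemma4p3:
  fixes M :: "'a measure" and F :: "real \<Rightarrow> 'a measure" and B :: "real \<Rightarrow> 'a \<Rightarrow> real"
    and \<beta> \<sigma> \<kappa> :: real and \<mu>\<^sub>0 :: "torus measure" and \<mu> :: "real \<Rightarrow> torus measure"
  assumes "kuramoto_space M F B"
    and "\<beta> > 0" and "\<sigma> > 0" and "\<kappa> > 0"
    and "\<kappa> < \<beta> * \<sigma>\<^sup>2 / 4"
    and "\<mu>\<^sub>0 \<in> borel_probs"
    and "kuramoto_mfg_solution M F B \<beta> \<sigma> \<kappa> \<mu>\<^sub>0 \<mu>"
  shows "converges_in_law \<mu> uniform_torus"
proof -
  from assms(7) obtain X\<^sub>0 \<alpha> where X0: "X\<^sub>0 \<in> F 0 \<rightarrow>\<^sub>M borel"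
    and \<alpha>: "\<alpha> \<in> controls F"
    and opt: "cost M B \<beta> \<sigma> \<kappa> \<mu> X\<^sub>0 \<alpha> = (INF \<alpha>\<in>controls F. cost M B \<beta> \<sigma> \<kappa> \<mu> X\<^sub>0 \<alpha>)"
    and law: "\<And>t. t \<ge> 0 \<Longrightarrow> \<mu> t = distr M borel (state B \<sigma> X\<^sub>0 \<alpha> t)"
    and probs: "\<And>t. t \<ge> 0 \<Longrightarrow> \<mu> t \<in> borel_probs"
    unfolding kuramoto_mfg_solution_def by auto
  interpret brownian_motion M F B
    using assms(1) by (rule kuramoto_space.axioms)
  interpret kuramoto_equilibrium M F B \<beta> \<sigma> \<kappa> X\<^sub>0 \<mu> \<alpha>
  proof unfold_locales
    show "cost M B \<beta> \<sigma> \<kappa> \<mu> X\<^sub>0 \<alpha> \<le> cost M B \<beta> \<sigma> \<kappa> \<mu> X\<^sub>0 \<alpha>'" if "\<alpha>' \<in> controls F" for \<alpha>'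
      unfolding opt using that by (rule INF_lower)
  qed (use assms X0 \<alpha> law probs in auto)
  show ?thesis
    by (rule flow_converges[OF assms(5)])
qed

end
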